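(* Let $K$ be a field with $\mathrm{char}(K)\neq2$ whose group $U$ of roots of unity contains $\{\pm1\}$ but no primitive $4$-th root of unity (this includes the case $U\simeq C_2$). Let $\mathcal{G}=\mathrm{GA}_2(K)$ and let $f\in\mathcal{G}$ be a reversible CR element with a reversor $r\in\mathcal{G}$ of order $4$. Then $r$ is conjugate in $\mathcal{G}$ to the linear map (an element of $\mathcal{A}\setminus\mathcal{B}$) defined by the matrix $R=\begin{pmatrix}0&-1\\1&0\end{pmatrix}$; hence $r^2$ is conjugate to $R^2=I=\mathrm{diag}(-1,-1)$.
   Context: $\mathcal{G}=\mathrm{GA}_2(K)$ is the group, under composition, of polynomial automorphisms of the affine plane over $K$: maps $x'=P(x,y),\ y'=Q(x,y)$ with $P,Q\in K[x,y]$ that have a polynomial inverse; elements are formal polynomial maps, i.e. distinguished by their polynomials. A matrix in $\mathrm{GL}(2,K)$ is identified with the corresponding linear map. A reversor of $f$ is an element $r\in\mathcal{G}$ with $rfr^{-1}=f^{-1}$; $f$ is reversible if it has a reversor. Let $\mathcal{A}\subset\mathcal{G}$ be the subgroup of affine maps $\boldsymbol{x}\mapsto M\boldsymbol{x}+\boldsymbol{a}$ ($M\in\mathrm{GL}(2,K)$, $\boldsymbol{a}\in K^2$), $\mathcal{E}\subset\mathcal{G}$ the subgroup of elementary maps $x'=\alpha x+P(y),\ y'=\beta y+v$ ($P\in K[y]$, $\alpha,\beta,v\in K$, $\alpha\beta\neq0$), and $\mathcal{B}=\mathcal{A}\cap\mathcal{E}$. Every $g\in\mathcal{G}\setminus\mathcal{B}$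 can be written as $g=g_n\circ\cdots\circ g_1$ with $n\ge1$ and factors alternating between $\mathcal{A}\setminus\mathcal{B}$ and $\mathcal{E}\setminus\mathcal{B}$; $n$ depends only on $g$ and is called the length $\mathrm{len}(g)$; put $\mathrm{len}(g)=0$ for $g\in\mathcal{B}$. An element is cyclically reduced if its length is even and $>0$. A CR element is an element of $\mathcal{G}$ that is conjugate in $\mathcal{G}$ to a cyclically reduced element. *)

theory Defs
  imports "HOL-Analysis.Analysis" "HOL-Algebra.Multiplicative_Group"
begin

text \<open>
  The ring \<open>K[x,y]\<close> is represented as \<open>K[y][x]\<close>, i.e. as the type \<open>'a poly poly\<close>: the outer
  indeterminate is \<open>x\<close>, and the coefficients are polynomials in \<open>y\<close>. A formal polynomial map
  \<open>x' = P(x,y), y' = Q(x,y)\<close> is the pair \<open>(P, Q)\<close>, so equality of maps is equality of polynomials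
  (and not of the induced functions, which differs over a finite field).
\<close>

type_synonym 'a pmap = "'a poly poly \<times> 'a poly poly"

definition Const :: "'a::field \<Rightarrow> 'a poly poly" where
  "Const a = [:[:a:]:]"

definition var_x :: "'a::field poly poly" where
  "var_x = [:0, 1:]"

definition var_y :: "'a::field poly poly" where
  "var_y = [:[:0, 1:]:]"

text \<open>\<open>eval_y p T\<close> is \<open>p(T)\<close> for \<open>p \<in> K[y]\<close>, and \<open>subst p (S, T)\<close> is \<open>p(S, T)\<close> for
  \<open>p \<in> K[x,y]\<close>.\<close>

definition eval_y :: "'a::field poly \<Rightarrow> 'a poly poly \<Rightarrow> 'a poly poly" where
  "eval_y p T = poly (map_poly Const p) T"

definition subst :: "'a::field poly poly \<Rightarrow> 'a pmap \<Rightarrow> 'a poly poly" where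
  "subst p g = poly (map_poly (\<lambda>c. eval_y c (snd g)) p) (fst g)"

definition pcomp :: "'a::field pmap \<Rightarrow> 'a pmap \<Rightarrow> 'a pmap" where
  "pcomp f g = (subst (fst f) g, subst (snd f) g)"

definition pid :: "'a::field pmap" where
  "pid = (var_x, var_y)"

definition GA2 :: "'a::field pmap monoid" where
  "GA2 = \<lparr>carrier = {f. \<exists>g. pcomp f g = pid \<and> pcomp g f = pid}, mult = pcomp, one = pid\<rparr>"

definition affine_map :: "'a::field^2^2 \<Rightarrow> 'a^2 \<Rightarrow> 'a pmap" where
  "affine_map M a =
     (Const (M $ 1 $ 1) * var_x + Const (M $ 1 $ 2) * var_y + Const (a $ 1),
      Const (M $ 2 $ 1) * var_x + Const (M $ 2 $ 2) * var_y + Const (a $ 2))"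

definition linear_map :: "'a::field^2^2 \<Rightarrow> 'a pmap" where
  "linear_map M = affine_map M 0"

definition Aff :: "'a::field pmap set" where
  "Aff = {affine_map M a | M a. invertible M}"

definition elementary_map :: "'a::field \<Rightarrow> 'a poly \<Rightarrow> 'a \<Rightarrow> 'a \<Rightarrow> 'a pmap" where
  "elementary_map \<alpha> P \<beta> v = (Const \<alpha> * var_x + eval_y P var_y, Const \<beta> * var_y + Const v)"

definition Elem :: "'a::field pmap set" where
  "Elem = {elementary_map \<alpha> P \<beta> v | \<alpha> P \<beta> v. \<alpha> * \<beta> \<noteq> 0}"

definition Bas :: "'a::field pmap set" where
  "Bas = Aff \<inter> Elem"

definition alternating :: "'a::field pmap list \<Rightarrow> bool" where
  "alternating gs \<longleftrightarrow> gs \<noteq> [] \<and> set gs \<subseteq> (Aff - Bas) \<union> (Elem - Bas) \<and>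
     successively (\<lambda>g h. (g \<in> Aff - Bas \<and> h \<in> Elem - Bas) \<or> (g \<in> Elem - Bas \<and> h \<in> Aff - Bas)) gs"

text \<open>The list \<open>[g\<^sub>n, \<dots>, g\<^sub>1]\<close> stands for the word \<open>g\<^sub>n \<circ> \<dots> \<circ> g\<^sub>1\<close>. The definite description
  is meaningful because, by the structure of \<open>GA\<^sub>2(K)\<close> as an amalgamated free product, such a word
  exists for every element outside \<open>Bas\<close> and its number of factors is unique.\<close>

definition len :: "'a::field pmap \<Rightarrow> nat" where
  "len g = (if g \<in> Bas then 0
     else THE n. \<exists>gs. alternating gs \<and> length gs = n \<and> foldr pcomp gs pid = g)"

definition conjugate_in :: "('b, 'c) monoid_scheme \<Rightarrow> 'b \<Rightarrow> 'b \<Rightarrow> bool" where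
  "conjugate_in G a b \<longleftrightarrow> (\<exists>h \<in> carrier G. b = h \<otimes>\<^bsub>G\<^esub> a \<otimes>\<^bsub>G\<^esub> inv\<^bsub>G\<^esub> h)"

definition cyclically_reduced :: "'a::field pmap \<Rightarrow> bool" where
  "cyclically_reduced g \<longleftrightarrow> g \<in> carrier GA2 \<and> even (len g) \<and> len g > 0"

definition CR_element :: "'a::field pmap \<Rightarrow> bool" where
  "CR_element f \<longleftrightarrow> f \<in> carrier GA2 \<and> (\<exists>g. cyclically_reduced g \<and> conjugate_in GA2 f g)"

definition reversor :: "'a::field pmap \<Rightarrow> 'a pmap \<Rightarrow> bool" where
  "reversor f r \<longleftrightarrow> r \<in> carrier GA2 \<and>
     r \<otimes>\<^bsub>GA2\<^esub> f \<otimes>\<^bsub>GA2\<^esub> inv\<^bsub>GA2\<^esub> r = inv\<^bsub>GA2\<^esub> f"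

definition reversible :: "'a::field pmap \<Rightarrow> bool" where
  "reversible f \<longleftrightarrow> (\<exists>r. reversor f r)"

definition roots_of_unity :: "'a::field set" where
  "roots_of_unity = {z. \<exists>n>0. z ^ n = 1}"

definition primitive_root_of_unity :: "nat \<Rightarrow> 'a::field \<Rightarrow> bool" where
  "primitive_root_of_unity n z \<longleftrightarrow> n > 0 \<and> z ^ n = 1 \<and> (\<forall>k. 0 < k \<and> k < n \<longrightarrow> z ^ k \<noteq> 1)"

definition R_mat :: "'a::field^2^2" where
  "R_mat = vector [vector [0, -1], vector [1, 0]]"

text \<open>The notions of inverse and element order from the algebra library are only meaningful in a
  group, so we show that \<open>GA2\<close> is one.\<close>

lemma eval_y_simps [simp]:
  "eval_y 0 T = 0" "eval_y (pCons a p) T = Const a + T * eval_y p T"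
  by (simp_all add: eval_y_def map_poly_pCons Const_def)

lemma Const_simps: "Const 0 = 0" "Const 1 = 1" "Const (a + b) = Const a + Const b"
  "Const (a * b) = Const a * Const b"
  by (simp_all add: Const_def one_pCons)

lemma eval_y_1 [simp]: "eval_y 1 T = 1"
  by (simp add: one_pCons) (simp add: Const_simps flip: one_pCons)

lemma eval_y_add: "eval_y (p + q) T = eval_y p T + eval_y q T"
  by (induction p q rule: poly_induct2) (simp_all add: Const_simps algebra_simps)

lemma eval_y_smult: "eval_y (Polynomial.smult a p) T = Const a * eval_y p T"
  by (induction p) (simp_all add: Const_simps algebra_simps)

lemma eval_y_mult: "eval_y (p * q) T = eval_y p T * eval_y q T"
  by (induction p) (simp_all add: Const_simps eval_y_add eval_y_smult algebra_simps)

lemma subst_simps [simp]: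
  "subst 0 g = 0" "subst (pCons c p) g = eval_y c (snd g) + fst g * subst p g"
  by (simp_all add: subst_def map_poly_pCons)

lemma subst_add: "subst (p + q) g = subst p g + subst q g"
  by (induction p q rule: poly_induct2) (simp_all add: eval_y_add algebra_simps)

lemma subst_smult: "subst (Polynomial.smult a p) g = eval_y a (snd g) * subst p g"
  by (induction p) (simp_all add: eval_y_mult algebra_simps)

lemma subst_mult: "subst (p * q) g = subst p g * subst q g"
  by (induction p) (simp_all add: subst_add subst_smult algebra_simps)

lemma subst_Const [simp]: "subst (Const a) g = Const a"
  by (simp add: Const_def)

lemma subst_var_x [simp]: "subst var_x g = fst g"
  by (simp add: var_x_def eval_y_1)

lemma subst_var_y [simp]: "subst var_y g = snd g"
  by (simp add: var_y_def Const_simps)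

lemma subst_eval_y: "subst (eval_y c T) g = eval_y c (subst T g)"
  by (induction c) (simp_all add: subst_add subst_mult)

lemma subst_pcomp: "subst p (pcomp f g) = subst (subst p f) g"
  by (induction p) (simp_all add: pcomp_def subst_add subst_mult subst_eval_y)

lemma eval_y_var_y: "eval_y c var_y = [:c:]"
  by (induction c) (simp_all add: var_y_def Const_def)

lemma subst_pid [simp]: "subst p pid = p"
  by (induction p) (simp_all add: pid_def eval_y_var_y, simp_all add: var_x_def)

lemma pcomp_assoc: "pcomp (pcomp f g) h = pcomp f (pcomp g h)"
proof -
  have "pcomp (pcomp f g) h = (subst (subst (fst f) g) h, subst (subst (snd f) g) h)"
    by (simp add: pcomp_def)
  also have "\<dots> = pcomp f (pcomp g h)"
    by (simp only: subst_pcomp[symmetric]) (simp add: pcomp_def)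
  finally show ?thesis .
qed

lemma pcomp_pid [simp]: "pcomp pid f = f" "pcomp f pid = f"
  by (simp_all add: pcomp_def) (simp add: pid_def)

lemma group_GA2: "group (GA2 :: 'a::field pmap monoid)"
proof (rule groupI, goal_cases)
  case (1 f g)
  then obtain f' g' where "pcomp f f' = pid" "pcomp f' f = pid" "pcomp g g' = pid" "pcomp g' g = pid"
    by (auto simp: GA2_def)
  then have "pcomp (pcomp f g) (pcomp g' f') = pid" "pcomp (pcomp g' f') (pcomp f g) = pid"
    by (metis pcomp_assoc pcomp_pid)+
  then show ?case
    unfolding GA2_def by (simp del: split_paired_Ex) blast
qed (auto simp: GA2_def pcomp_assoc intro: exI[of _ pid] simp del: split_paired_Ex split_paired_All)

end

theory Submission
  imports Defs "HOL-Computational_Algebra.Formal_Laurent_Series"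
begin

text \<open>
  An element \<open>r\<close> of order 4 is conjugate to an affine
  or elementary map: take a reduced word of minimal length among the conjugates of \<open>r\<close>; odd
  length \<open>> 1\<close> can be shortened, and even length \<open>> 0\<close> makes all powers nontrivial. Without
  primitive fourth roots of unity, an elementary map with \<open>q\<^sup>4 = 1\<close> satisfies \<open>q\<^sup>2 = 1\<close>, and an affine
  map of order 4 has linear part \<open>M\<close> with \<open>M\<^sup>2 = -1\<close> and a fixed point, hence is conjugate to \<open>R\<close>.

  The existence of words (van der Kulk's theorem, in every characteristic) comes from a degree
  estimate. Embed \<open>K[x,y]\<close> into \<open>K((\<tau>))((\<xi>))\<close> by \<open>x = 1/\<xi>\<close>, \<open>y = \<tau>/\<xi>\<close>, so that the degree becomes the
  order of the pole in \<open>\<xi>\<close>. Cancellation in \<open>F(P,Q)\<close> is resolved by successive monomial changes of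
  coordinates (blow-ups). The logarithmic form \<open>ds/s \<and> dz/z\<close> is invariant under them up to sign, so
  its order bounds the total loss of degree. Since \<open>dP \<and> dQ\<close> is a nonzero multiple of \<open>dx \<and> dy\<close>, all
  nonconstant \<open>F(P,Q)\<close> have degree at least 2 unless one of \<open>deg P\<close>, \<open>deg Q\<close> divides the other.
\<close>

hide_const (open) up_ring.monom up_ring.coeff Coset.order UnivPoly.deg

notation fls_nth (infixl \<open>$$\<close> 75)

section \<open>The degree valuation on iterated Laurent series\<close>

text \<open>A derivative may raise the subdegree, so products are expanded between lower bounds
  shared by all factors involved; the additional terms vanish.\<close>

lemma fls_times_nth_bounds:
  fixes f g :: "'b::{comm_monoid_add,mult_zero} fls"
  assumes "a \<le> fls_subdegree f" "b \<le> fls_subdegree g"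
  shows "(f * g) $$ n = (\<Sum>i=a..n-b. f $$ i * g $$ (n - i))"
  unfolding fls_times_nth(2)[of f g n]
proof (rule sum.mono_neutral_left)
  show "{fls_subdegree f..n - fls_subdegree g} \<subseteq> {a..n-b}" using assms by auto
  show "\<forall>i\<in>{a..n - b} - {fls_subdegree f..n - fls_subdegree g}. f $$ i * g $$ (n - i) = 0"
  proof
    fix i assume "i \<in> {a..n - b} - {fls_subdegree f..n - fls_subdegree g}"
    then have "i < fls_subdegree f \<or> n - i < fls_subdegree g" by auto
    then show "f $$ i * g $$ (n - i) = 0" by (metis fls_eq0_below_subdegree mult_zero_left mult_zero_right)
  qed
qed auto

text \<open>This is the valuation inequality with 0 of infinite valuation; the convention
  \<open>fls_subdegree 0 = 0\<close> would be wrong at zero.\<close>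

definition val_ge :: "'b::zero fls \<Rightarrow> int \<Rightarrow> bool" where
  "val_ge f n \<longleftrightarrow> (\<forall>i<n. f $$ i = 0)"

lemma val_ge_iff: "f \<noteq> 0 \<Longrightarrow> val_ge f n \<longleftrightarrow> n \<le> fls_subdegree f"
  by (meson fls_eq0_below_subdegree fls_subdegree_geI linorder_not_le nth_fls_subdegree_nonzero
      order_less_le_trans val_ge_def)

lemma val_ge_subdegree: "val_ge f (fls_subdegree f)"
  by (simp add: val_ge_def)

lemma val_ge_0 [simp]: "val_ge 0 n"
  by (simp add: val_ge_def)

lemma val_ge_add: "val_ge f n \<Longrightarrow> val_ge g n \<Longrightarrow> val_ge (f + g) n"
  for f g :: "'b::monoid_add fls"
  by (simp add: val_ge_def)

lemma val_ge_diff: "val_ge f n \<Longrightarrow> val_ge g n \<Longrightarrow> val_ge (f - g) n"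
  for f g :: "'b::group_add fls"
  by (simp add: val_ge_def)

lemma val_ge_mono: "val_ge f n \<Longrightarrow> m \<le> n \<Longrightarrow> val_ge f m"
  by (auto simp: val_ge_def)

lemma val_ge_mult: "val_ge f m \<Longrightarrow> val_ge g n \<Longrightarrow> val_ge (f * g) (m + n)"
  for f g :: "'b::idom fls"
  by (cases "f = 0 \<or> g = 0") (auto simp: val_ge_iff)

lemma val_ge_0_mult_nth_0: "val_ge f 0 \<Longrightarrow> val_ge g 0 \<Longrightarrow> (f * g) $$ 0 = f $$ 0 * g $$ 0"
  for f g :: "'b::idom fls"
  by (cases "f = 0 \<or> g = 0") (auto simp: val_ge_iff fls_times_nth_bounds[of 0 f 0 g])

text \<open>On series in \<open>\<xi>\<close> over \<open>K((\<tau>))\<close> this is the derivation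
  by \<open>\<tau>\<close>, whereas \<open>fls_deriv\<close> on the outer level is the derivation by
  \<open>\<xi>\<close>.\<close>

definition coeff_deriv :: "'a::field fls fls \<Rightarrow> 'a fls fls" where
  "coeff_deriv f = Abs_fls (\<lambda>n. fls_deriv (f $$ n))"

lemma coeff_deriv_nth [simp]: "coeff_deriv f $$ n = fls_deriv (f $$ n)"
  unfolding coeff_deriv_def
  by (rule nth_Abs_fls_lower_bound[of "fls_subdegree f"]) simp

lemma coeff_deriv_add: "coeff_deriv (f + g) = coeff_deriv f + coeff_deriv g"
  by (rule fls_eqI) simp

lemma coeff_deriv_0 [simp]: "coeff_deriv 0 = 0"
  by (rule fls_eqI) simp

lemma val_ge_coeff_deriv: "val_ge f n \<Longrightarrow> val_ge (coeff_deriv f) n"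
  by (simp add: val_ge_def)

lemma val_ge_X_deriv: "val_ge f n \<Longrightarrow> val_ge (fls_X * fls_deriv f) n"
  for f :: "'b::field fls"
  by (auto simp: val_ge_def fls_X_times_conv_shift)

text \<open>The Leibniz rule of \<open>K((\<tau>))\<close> is applied to each term of the Cauchy
  product; the common range \<open>a..n-b\<close> serves all three products.\<close>

lemma coeff_deriv_mult: "coeff_deriv (f * g) = f * coeff_deriv g + g * coeff_deriv f"
proof (cases "f = 0 \<or> g = 0")
  case True then show ?thesis by auto
next
  case False
  define a b where "a = fls_subdegree f" and "b = fls_subdegree g"
  have *: "(p * q) $$ n = (\<Sum>i=a..n-b. p $$ i * q $$ (n - i))" if "val_ge p a" "val_ge q b" for p q :: "'a fls fls" and n
    using that by (cases "p = 0 \<or> q = 0") (auto simp: val_ge_iff fls_times_nth_bounds)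
  have v: "val_ge f a" "val_ge g b" "val_ge (coeff_deriv f) a" "val_ge (coeff_deriv g) b"
    by (simp_all add: a_def b_def val_ge_subdegree val_ge_coeff_deriv)
  show ?thesis
  proof (rule fls_eqI)
    fix n
    have "coeff_deriv (f * g) $$ n = fls_deriv (\<Sum>i=a..n-b. f $$ i * g $$ (n - i))"
      by (simp add: *[OF v(1,2)])
    also have "\<dots> = (\<Sum>i=a..n-b. f $$ i * coeff_deriv g $$ (n - i)) + (\<Sum>i=a..n-b. coeff_deriv f $$ i * g $$ (n - i))"
      by (simp add: fls_deriv_sum sum.distrib)
    also have "\<dots> = (f * coeff_deriv g) $$ n + (coeff_deriv f * g) $$ n"
      by (simp only: *[OF v(1,4)] *[OF v(3,2)])
    finally show "coeff_deriv (f * g) $$ n = (f * coeff_deriv g + g * coeff_deriv f) $$ n"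
      by (simp add: mult.commute)
  qed
qed

definition cst :: "'a::field \<Rightarrow> 'a fls fls" where
  "cst c = fls_const (fls_const c)"

lemma cst_simps [simp]: "cst 0 = 0" "cst 1 = 1" "cst c = 0 \<longleftrightarrow> c = 0"
  by (simp_all add: cst_def)

lemma cst_add: "cst (a + b) = cst a + cst b"
  by (simp add: cst_def fls_plus_const)

lemma cst_mult: "cst (a * b) = cst a * cst b"
  by (simp add: cst_def)

lemma cst_uminus: "cst (- a) = - cst a"
  by (simp add: cst_def)

lemma subdegree_cst [simp]: "fls_subdegree (cst c) = 0"
  by (simp add: cst_def)

section \<open>The bracket\<close>

text \<open>\<open>df \<and> dg\<close> is this series times
  \<open>d\<xi>/\<xi> \<and> d\<tau>\<close>. The factor \<open>fls_X\<close> keeps the derivation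
  by \<open>\<xi>\<close> from lowering the order.\<close>

definition bracket :: "'a::field fls fls \<Rightarrow> 'a fls fls \<Rightarrow> 'a fls fls" where
  "bracket f g = fls_X * fls_deriv f * coeff_deriv g - fls_X * fls_deriv g * coeff_deriv f"

definition derivation :: "('a::field fls fls \<Rightarrow> 'a fls fls) \<Rightarrow> bool" where
  "derivation \<delta> \<longleftrightarrow> (\<forall>a b. \<delta> (a + b) = \<delta> a + \<delta> b) \<and> (\<forall>a b. \<delta> (a * b) = a * \<delta> b + b * \<delta> a) \<and>
    (\<forall>c. \<delta> (cst c) = 0)"

lemma val_ge_bracket: "val_ge (bracket f g) (fls_subdegree f + fls_subdegree g)"
proof -
  have "val_ge (fls_X * fls_deriv f * coeff_deriv g) (fls_subdegree f + fls_subdegree g)"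
    by (intro val_ge_mult val_ge_X_deriv val_ge_coeff_deriv val_ge_subdegree)
  moreover have "val_ge (fls_X * fls_deriv g * coeff_deriv f) (fls_subdegree g + fls_subdegree f)"
    by (intro val_ge_mult val_ge_X_deriv val_ge_coeff_deriv val_ge_subdegree)
  ultimately show ?thesis unfolding bracket_def by (intro val_ge_diff) (simp_all add: add.commute)
qed

lemma subdegree_bracket: "bracket f g \<noteq> 0 \<Longrightarrow> fls_subdegree f + fls_subdegree g \<le> fls_subdegree (bracket f g)"
  using val_ge_bracket val_ge_iff by blast

lemma bracket_antisym: "bracket g f = - bracket f g"
  by (simp add: bracket_def)

lemma bracket_self [simp]: "bracket f f = 0"
  by (simp add: bracket_def)

lemma coeff_deriv_cst [simp]: "coeff_deriv (cst c) = 0"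
  by (rule fls_eqI) (simp add: cst_def)

lemma derivation_bracket: "derivation (bracket f)"
  unfolding derivation_def
proof (intro conjI allI)
  fix a b c
  show "bracket f (a + b) = bracket f a + bracket f b"
    unfolding bracket_def coeff_deriv_add fls_deriv_add by (simp only: algebra_simps)
  show "bracket f (a * b) = a * bracket f b + b * bracket f a"
    unfolding bracket_def coeff_deriv_mult fls_deriv_mult by (simp only: algebra_simps)
  show "bracket f (cst c) = 0"
    unfolding bracket_def coeff_deriv_cst by (simp add: cst_def)
qed

lemma derivation_bracket_left: "derivation (\<lambda>f. bracket f g)"
  unfolding derivation_def
proof (intro conjI allI)
  fix a b c
  show "bracket (a + b) g = bracket a g + bracket b g"
    unfolding bracket_def coeff_deriv_add fls_deriv_add by (simp only: algebra_simps)
  show "bracket (a * b) g = a * bracket b g + b * bracket a g"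
    unfolding bracket_def coeff_deriv_mult fls_deriv_mult by (simp only: algebra_simps)
  show "bracket (cst c) g = 0"
    unfolding bracket_def coeff_deriv_cst by (simp add: cst_def)
qed

lemma derivationD:
  assumes "derivation \<delta>"
  shows "\<delta> (a + b) = \<delta> a + \<delta> b" "\<delta> (a * b) = a * \<delta> b + b * \<delta> a" "\<delta> (cst c) = 0" "\<delta> 0 = 0" "\<delta> 1 = 0"
proof -
  show "\<delta> (a + b) = \<delta> a + \<delta> b" "\<delta> (a * b) = a * \<delta> b + b * \<delta> a" and c: "\<And>c. \<delta> (cst c) = 0"
    using assms by (auto simp: derivation_def)
  from c[of 0] c[of 1] show "\<delta> 0 = 0" "\<delta> 1 = 0" by simp_all
qed

text \<open>Multiplying the power rule by \<open>a\<close> avoids the truncated exponent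
  \<open>n - 1\<close> and fits the logarithmic form.\<close>

lemma derivation_power:
  assumes "derivation \<delta>"
  shows "a * \<delta> (a ^ n) = of_nat n * a ^ n * \<delta> a"
  by (induction n) (simp_all add: derivationD[OF assms] algebra_simps)

section \<open>Evaluation of polynomials at series and the chain rule\<close>

definition eval1 :: "'a::field fls fls \<Rightarrow> 'a poly \<Rightarrow> 'a fls fls" where
  "eval1 B q = poly (map_poly cst q) B"

definition eval2 :: "'a::field fls fls \<Rightarrow> 'a fls fls \<Rightarrow> 'a poly poly \<Rightarrow> 'a fls fls" where
  "eval2 A B p = poly (map_poly (eval1 B) p) A"

lemma eval1_simps [simp]: "eval1 B 0 = 0" "eval1 B (pCons a q) = cst a + B * eval1 B q"
  by (simp_all add: eval1_def map_poly_pCons)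

lemma eval2_simps [simp]: "eval2 A B 0 = 0" "eval2 A B (pCons q p) = eval1 B q + A * eval2 A B p"
  by (simp_all add: eval2_def map_poly_pCons)

lemma eval1_add: "eval1 B (p + q) = eval1 B p + eval1 B q"
  by (induction p q rule: poly_induct2) (simp_all add: cst_add algebra_simps)

lemma eval1_smult: "eval1 B (Polynomial.smult a p) = cst a * eval1 B p"
  by (induction p) (simp_all add: cst_mult algebra_simps)

lemma eval1_mult: "eval1 B (p * q) = eval1 B p * eval1 B q"
  by (induction p) (simp_all add: eval1_add eval1_smult algebra_simps)

lemma eval2_add: "eval2 A B (p + q) = eval2 A B p + eval2 A B q"
  by (induction p q rule: poly_induct2) (simp_all add: eval1_add algebra_simps)

lemma eval2_smult: "eval2 A B (Polynomial.smult q p) = eval1 B q * eval2 A B p"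
  by (induction p) (simp_all add: eval1_mult algebra_simps)

lemma eval2_mult: "eval2 A B (p * q) = eval2 A B p * eval2 A B q"
  by (induction p) (simp_all add: eval2_add eval2_smult algebra_simps)

lemma eval2_uminus: "eval2 A B (- p) = - eval2 A B p"
  using eval2_add[of A B p "-p"] by (simp add: eq_neg_iff_add_eq_0 add.commute)

lemma eval2_diff: "eval2 A B (p - q) = eval2 A B p - eval2 A B q"
  using eval2_add[of A B p "-q"] by (simp add: eval2_uminus)

lemma eval2_Const [simp]: "eval2 A B (Const c) = cst c"
  by (simp add: Const_def)

lemma eval2_eval_y: "eval2 A B (eval_y q T) = eval1 (eval2 A B T) q"
  by (induction q) (simp_all add: eval2_add eval2_mult)

lemma eval2_subst: "eval2 A B (subst p g) = eval2 (eval2 A B (fst g)) (eval2 A B (snd g)) p"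
  by (induction p) (simp_all add: eval2_add eval2_mult eval2_eval_y)

lemma eval2_var [simp]: "eval2 A B var_x = A" "eval2 A B var_y = B"
  by (simp_all add: var_x_def var_y_def one_pCons[symmetric]) (simp_all add: one_pCons)

lemma derivation_eval1:
  assumes "derivation \<delta>"
  shows "\<delta> (eval1 B q) = eval1 B (pderiv q) * \<delta> B"
  by (induction q) (simp_all add: derivationD[OF assms] pderiv_pCons eval1_add algebra_simps)

lemma derivation_eval2:
  assumes "derivation \<delta>"
  shows "\<delta> (eval2 A B p) = eval2 A B (pderiv p) * \<delta> A + eval2 A B (map_poly pderiv p) * \<delta> B"
proof (induction p)
  case (pCons q p)
  then show ?case
    by (simp add: derivationD[OF assms] derivation_eval1[OF assms] pderiv_pCons eval2_add
        map_poly_pCons algebra_simps)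
qed (simp add: derivationD[OF assms])

text \<open>This is the chain rule: the first factor is the Jacobian determinant of
  \<open>(p, q)\<close>, where \<open>pderiv\<close> differentiates in \<open>x\<close> and
  \<open>map_poly pderiv\<close> in \<open>y\<close>.\<close>

lemma bracket_eval2:
  "bracket (eval2 A B p) (eval2 A B q) =
    eval2 A B (pderiv p * map_poly pderiv q - map_poly pderiv p * pderiv q) * bracket A B"
proof -
  have 1: "bracket (eval2 A B p) g = eval2 A B (pderiv p) * bracket A g + eval2 A B (map_poly pderiv p) * bracket B g" for g
    by (rule derivation_eval2[OF derivation_bracket_left])
  have 2: "bracket g (eval2 A B q) = eval2 A B (pderiv q) * bracket g A + eval2 A B (map_poly pderiv q) * bracket g B" for g
    by (rule derivation_eval2[OF derivation_bracket])
  show ?thesis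
    unfolding 1 2 by (simp add: eval2_mult eval2_diff bracket_antisym[of A B] algebra_simps)
qed

section \<open>Monomial coordinate changes\<close>

lemma derivation_monomial:
  assumes "derivation \<delta>"
  shows "s * z * \<delta> (s ^ m * z ^ n) = s ^ m * z ^ n * (of_nat m * z * \<delta> s + of_nat n * s * \<delta> z)"
proof -
  have "s * z * \<delta> (s ^ m * z ^ n) = s * (s ^ m * (z * \<delta> (z ^ n))) + z * (z ^ n * (s * \<delta> (s ^ m)))"
    by (simp add: derivationD[OF assms] algebra_simps)
  then show ?thesis
    by (simp add: derivation_power[OF assms] algebra_simps)
qed

text \<open>The form \<open>ds/s \<and> dz/z\<close> gets multiplied by the determinant of the
  exponent matrix, which is 1. Denominators are cleared.\<close>

lemma bracket_monomial:
  assumes "\<alpha> * f = \<beta> * e + 1" "s \<noteq> 0" "z \<noteq> 0"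
  shows "bracket s z * ((s ^ f * z ^ \<beta>) * (s ^ e * z ^ \<alpha>)) = s * z * bracket (s ^ f * z ^ \<beta>) (s ^ e * z ^ \<alpha>)"
proof -
  define u w where "u = s ^ f * z ^ \<beta>" and "w = s ^ e * z ^ \<alpha>"
  have 1: "s * z * bracket u g = u * (of_nat f * z * bracket s g + of_nat \<beta> * s * bracket z g)" for g
    unfolding u_def by (rule derivation_monomial[OF derivation_bracket_left])
  have 2: "s * z * bracket g w = w * (of_nat e * z * bracket g s + of_nat \<alpha> * s * bracket g z)" for g
    unfolding w_def by (rule derivation_monomial[OF derivation_bracket])
  have "s * z * (s * z * bracket u w) =
      u * (of_nat f * z * (s * z * bracket s w) + of_nat \<beta> * s * (s * z * bracket z w))"
    unfolding 1 by (simp add: algebra_simps)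
  also have "\<dots> = s * z * (u * w * ((of_nat \<alpha> * of_nat f - of_nat \<beta> * of_nat e) * bracket s z))"
    unfolding 2 by (simp add: bracket_antisym[of s z] algebra_simps)
  also have "of_nat \<alpha> * of_nat f - of_nat \<beta> * of_nat e = (1 :: 'a fls fls)"
    using assms(1) by (metis add_diff_cancel_left' of_nat_1 of_nat_add of_nat_mult)
  finally show ?thesis
    using assms(2,3) by (simp add: u_def w_def)
qed

text \<open>The exponent matrix with rows \<open>(f, \<beta>)\<close> and
  \<open>(e, \<alpha>)\<close> has determinant 1. Its inverse, with rows
  \<open>(\<alpha>, -\<beta>)\<close> and \<open>(-e, f)\<close>, is where \<open>s\<close> and
  \<open>z\<close> come from.\<close>

lemma monomial_change:
  fixes u w :: "'b::field"
  assumes "\<alpha> * f = \<beta> * e + 1" "u \<noteq> 0" "w \<noteq> 0"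
  defines "s \<equiv> u ^ \<alpha> / w ^ \<beta>" and "z \<equiv> w ^ f / u ^ e"
  shows "s ^ f * z ^ \<beta> = u" "s ^ e * z ^ \<alpha> = w"
proof -
  have "u ^ (f * \<alpha>) = u * u ^ (e * \<beta>)" "w ^ (f * \<alpha>) = w * w ^ (e * \<beta>)"
    using assms(1) by (simp_all add: mult.commute)
  then show "s ^ f * z ^ \<beta> = u" "s ^ e * z ^ \<alpha> = w"
    using assms(2,3)
    by (simp_all add: s_def z_def power_divide power_mult[symmetric] field_simps)
qed

lemma subdegree_divide: "f \<noteq> 0 \<Longrightarrow> g \<noteq> 0 \<Longrightarrow> fls_subdegree (f / g) = fls_subdegree f - fls_subdegree g"
  for f g :: "'b::field fls"
  by (metis add_diff_cancel_right' divide_eq_0_iff fls_subdegree_mult nonzero_eq_divide_eq)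

lemma subdegree_power: "f \<noteq> 0 \<Longrightarrow> fls_subdegree (f ^ n) = int n * fls_subdegree f"
  for f :: "'b::field fls"
  by (simp add: fls_subdegree_pow)

lemma eval1_monom [simp]: "eval1 B (monom c n) = cst c * B ^ n"
  by (simp add: eval1_def map_poly_monom poly_monom)

lemma eval2_monom [simp]: "eval2 A B (monom q n) = eval1 B q * A ^ n"
  by (simp add: eval2_def map_poly_monom poly_monom)

lemma eval2_sum: "eval2 A B (\<Sum>i\<in>S. p i) = (\<Sum>i\<in>S. eval2 A B (p i))"
  by (induction S rule: infinite_finite_induct) (simp_all add: eval2_add)

section \<open>Supports and edge polynomials\<close>

definition supp :: "'a::zero poly poly \<Rightarrow> (nat \<times> nat) set" where
  "supp G = {(i, j). coeff (coeff G i) j \<noteq> 0}"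

lemma finite_supp [simp]: "finite (supp G)"
proof -
  have "supp G \<subseteq> Sigma {..degree G} (\<lambda>i. {..degree (coeff G i)})"
  proof
    fix p assume p: "p \<in> supp G"
    obtain i j where ij: "p = (i, j)" by (cases p)
    have nz: "coeff (coeff G i) j \<noteq> 0" using p ij by (simp add: supp_def)
    then have "coeff G i \<noteq> 0" by auto
    then show "p \<in> Sigma {..degree G} (\<lambda>i. {..degree (coeff G i)})"
      using nz ij by (simp add: le_degree)
  qed
  then show ?thesis by (rule finite_subset) simp
qed

lemma supp_empty_iff [simp]: "supp G = {} \<longleftrightarrow> G = 0"
  by (auto simp: supp_def poly_eq_iff)

lemma poly_eq_sum_supp:
  "G = (\<Sum>p\<in>supp G. monom (monom (coeff (coeff G (fst p)) (snd p)) (snd p)) (fst p))"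
proof (intro poly_eqI)
  fix i j
  have "coeff (coeff (\<Sum>p\<in>supp G. monom (monom (coeff (coeff G (fst p)) (snd p)) (snd p)) (fst p)) i) j
      = (\<Sum>p\<in>supp G. if p = (i, j) then coeff (coeff G i) j else 0)"
    unfolding coeff_sum by (rule sum.cong) auto
  also have "\<dots> = coeff (coeff G i) j"
    by (subst sum.delta, rule finite_supp) (simp add: supp_def)
  finally show "coeff (coeff G i) j =
      coeff (coeff (\<Sum>p\<in>supp G. monom (monom (coeff (coeff G (fst p)) (snd p)) (snd p)) (fst p)) i) j"
    by simp
qed

lemma eval2_eq_sum_supp:
  "eval2 A B G = (\<Sum>p\<in>supp G. cst (coeff (coeff G (fst p)) (snd p)) * A ^ fst p * B ^ snd p)"
  by (subst poly_eq_sum_supp) (simp add: eval2_sum mult_ac)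

text \<open>Splitting off the lowest power of the variable leaves a polynomial of degree at most
  \<open>k\<close>. That power does not vanish at \<open>c\<close>, so the multiplicity of
  \<open>c\<close> is at most this degree.\<close>

lemma order_le_support_width:
  fixes q :: "'b::field poly"
  assumes "q \<noteq> 0" "\<And>m n. coeff q m \<noteq> 0 \<Longrightarrow> coeff q n \<noteq> 0 \<Longrightarrow> m \<le> n + k" "c \<noteq> 0"
  shows "order c q \<le> k"
proof -
  define m where "m = (LEAST n. coeff q n \<noteq> 0)"
  have ex: "\<exists>n. coeff q n \<noteq> 0" using assms(1) by (auto simp: poly_eq_iff)
  have m: "coeff q m \<noteq> 0" unfolding m_def by (rule LeastI_ex[OF ex])
  have low: "coeff q n = 0" if "n < m" for n
    using that unfolding m_def by (metis not_less_Least)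
  have q: "q = monom 1 m * poly_shift m q"
    by (rule poly_eqI) (auto simp: coeff_monom_mult coeff_poly_shift low)
  have nz: "poly_shift m q \<noteq> 0" using q assms(1) by auto
  have "degree (poly_shift m q) \<le> k"
  proof (rule degree_le, intro allI impI, rule ccontr)
    fix i assume "k < i" "coeff (poly_shift m q) i \<noteq> 0"
    then show False using assms(2)[of "i + m" m] m by (simp add: coeff_poly_shift)
  qed
  moreover have "order c (monom 1 m) = 0"
    by (rule order_0I) (simp add: poly_monom assms(3))
  ultimately show ?thesis
    using order_mult[of "monom 1 m" "poly_shift m q" c] q assms(1) nz
    by (metis add_0 order_degree le_trans)
qed

text \<open>Distinct exponents exclude cancellation, and they all lie in a window of length
  \<open>k\<close>. In the applications \<open>q\<close> is the polynomial of an edge of a Newton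
  polygon.\<close>

lemma sum_monom_order_le:
  fixes c :: "'i \<Rightarrow> 'b::field"
  assumes "finite S" "S \<noteq> {}" "inj_on t S" "\<And>p. p \<in> S \<Longrightarrow> c p \<noteq> 0"
    and "\<And>p p'. p \<in> S \<Longrightarrow> p' \<in> S \<Longrightarrow> t p \<le> t p' + k"
  defines "q \<equiv> \<Sum>p\<in>S. monom (c p) (t p)"
  shows "q \<noteq> 0" and "a \<noteq> 0 \<Longrightarrow> order a q \<le> k"
proof -
  have co: "coeff q n = (\<Sum>p\<in>S. if t p = n then c p else 0)" for n
    by (simp add: q_def coeff_sum)
  have ne: "\<exists>p\<in>S. t p = n" if "coeff q n \<noteq> 0" for n
  proof (rule ccontr)
    assume "\<not> ?thesis"
    then have "coeff q n = 0" unfolding co by (intro sum.neutral) auto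
    with that show False by simp
  qed
  obtain p0 where p0: "p0 \<in> S" using assms(2) by auto
  have "coeff q (t p0) = (\<Sum>p\<in>S. if p = p0 then c p0 else 0)"
    unfolding co using assms(3) p0 by (intro sum.cong) (auto dest: inj_onD)
  also have "\<dots> = c p0" using p0 assms(1) by simp
  finally show "q \<noteq> 0" using assms(4)[OF p0] by auto
  then show "a \<noteq> 0 \<Longrightarrow> order a q \<le> k"
    using assms(5) ne by (intro order_le_support_width) blast+
qed

section \<open>Residues\<close>

text \<open>The coefficient at 0 is the residue map, which is multiplicative and additive on series
  without a pole.\<close>

lemma eval1_val_ge_0:
  assumes "val_ge z 0"
  shows "val_ge (eval1 z q) 0 \<and> eval1 z q $$ 0 = poly (map_poly fls_const q) (z $$ 0)"
proof (induction q)
  case (pCons a q)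
  have c: "val_ge (cst a) 0" by (simp add: cst_def val_ge_def)
  have m: "val_ge (z * eval1 z q) 0"
    using val_ge_mult[of z 0 "eval1 z q" 0] pCons assms by simp
  show ?case
    using pCons assms val_ge_add[OF c m]
    by (simp add: val_ge_0_mult_nth_0 map_poly_pCons cst_def)
qed simp

text \<open>Since \<open>s\<close> has residue 0, only the part of \<open>H\<close> free of the
  outer variable survives in the residue.\<close>

lemma eval2_val_ge_0:
  assumes "val_ge z 0" "val_ge s 1"
  shows "val_ge (eval2 s z H) 0" "eval2 s z H $$ 0 = poly (map_poly fls_const (coeff H 0)) (z $$ 0)"
proof -
  have s: "val_ge s 0" "s $$ 0 = 0" using assms(2) by (auto simp: val_ge_def)
  have v: "val_ge (eval2 s z H) 0" for H
  proof (induction H)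
    case (pCons q H)
    then have "val_ge (s * eval2 s z H) 0" using val_ge_mult[of s 0 "eval2 s z H" 0] s by simp
    then show ?case using eval1_val_ge_0[OF assms(1)] by (simp add: val_ge_add)
  qed simp
  then show "val_ge (eval2 s z H) 0" .
  show "eval2 s z H $$ 0 = poly (map_poly fls_const (coeff H 0)) (z $$ 0)"
    using s v eval1_val_ge_0[OF assms(1)]
    by (cases H) (simp add: val_ge_0_mult_nth_0)
qed

text \<open>At a pole the leading term has a strictly larger pole order than all the others, so
  nothing can cancel it.\<close>

lemma poly_fls_const_pole:
  fixes a :: "'b::field fls"
  assumes "q \<noteq> 0" "fls_subdegree a < 0"
  shows "poly (map_poly fls_const q) a \<noteq> 0"
    "fls_subdegree (poly (map_poly fls_const q) a) = int (degree q) * fls_subdegree a"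
proof -
  have a: "a \<noteq> 0" using assms(2) by auto
  have "poly (map_poly fls_const q) a \<noteq> 0 \<and>
      fls_subdegree (poly (map_poly fls_const q) a) = int (degree q) * fls_subdegree a"
    using assms(1)
  proof (induction q)
    case (pCons x p)
    show ?case
    proof (cases "p = 0")
      case True then show ?thesis using pCons by (simp add: map_poly_pCons)
    next
      case False
      define r where "r = a * poly (map_poly fls_const p) a"
      have r: "r \<noteq> 0" "fls_subdegree r = int (degree (pCons x p)) * fls_subdegree a"
        using pCons.IH False a by (simp_all add: r_def algebra_simps)
      then have neg: "fls_subdegree r < 0" using assms(2) False by (simp add: mult_less_0_iff)
      then have "fls_subdegree (fls_const x + r) = fls_subdegree r"
        using r by (cases "x = 0") (simp_all add: fls_subdegree_add_eq2)
      moreover have "fls_const x + r \<noteq> 0" using calculation neg by auto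
      ultimately show ?thesis using r by (simp add: map_poly_pCons r_def)
    qed
  qed simp
  then show "poly (map_poly fls_const q) a \<noteq> 0"
    "fls_subdegree (poly (map_poly fls_const q) a) = int (degree q) * fls_subdegree a" by blast+
qed

text \<open>\<open>K\<close> is algebraically closed in \<open>K((\<tau>))\<close>. A pole is
  excluded by the previous lemma; otherwise subtracting the constant term leaves a root of positive
  order or 0, and such a root must be 0.\<close>

lemma poly_fls_const_root:
  fixes a :: "'b::field fls"
  assumes "q \<noteq> 0" "poly (map_poly fls_const q) a = 0"
  obtains c where "a = fls_const c"
proof -
  \<comment> \<open>A nonzero root of positive order forces the constant coefficient to vanish;
    dividing by \<open>b\<close> then lowers the degree of the polynomial.\<close>
  have pos: "b = 0" if "fls_subdegree b > 0 \<or> b = 0" "p \<noteq> 0" "poly (map_poly fls_const p) b = 0"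
    for p and b :: "'b fls"
    using that(2,3)
  proof (induction p)
    case (pCons x p)
    show ?case
    proof (rule ccontr)
      assume b: "b \<noteq> 0"
      then have sb: "fls_subdegree b > 0" using that(1) by simp
      have v: "val_ge (poly (map_poly fls_const p) b) 0" for p
      proof (induction p)
        case (pCons y p)
        have "val_ge (b * poly (map_poly fls_const p) b) 0"
          using val_ge_mult[of b 0 _ 0] pCons sb b by (simp add: val_ge_iff)
        moreover have "val_ge (fls_const y) 0" by (simp add: val_ge_def)
        ultimately show ?case by (simp add: map_poly_pCons val_ge_add)
      qed simp
      have "val_ge b 0" "b $$ 0 = 0" using sb b by (simp_all add: val_ge_iff)
      then have "poly (map_poly fls_const (pCons x p)) b $$ 0 = x"
        using v[of p] by (simp add: map_poly_pCons val_ge_0_mult_nth_0)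
      then have "x = 0" using pCons.prems(2) by simp
      then show False using pCons b by (simp add: map_poly_pCons)
    qed
  qed simp
  show ?thesis
  proof (cases "a = 0 \<or> fls_subdegree a \<ge> 0")
    case True
    define c where "c = a $$ 0"
    define p where "p = pcompose q [:c, 1:]"
    have "poly (map_poly fls_const (pcompose r [:c, 1:])) (a - fls_const c) = poly (map_poly fls_const r) a" for r
    proof (induction r)
      case (pCons y r)
      have add: "poly (map_poly fls_const (x + y)) b = poly (map_poly fls_const x) b + poly (map_poly fls_const y) b"
        for x y :: "'b poly" and b
        by (induction x y rule: poly_induct2) (simp_all add: map_poly_pCons fls_plus_const[symmetric] algebra_simps)
      have smult: "poly (map_poly fls_const (Polynomial.smult d x)) b = fls_const d * poly (map_poly fls_const x) b"
        for x :: "'b poly" and b d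
        by (induction x) (simp_all add: map_poly_pCons algebra_simps)
      show ?case using pCons
        by (simp add: pcompose_pCons add smult map_poly_pCons algebra_simps)
    qed simp
    then have "poly (map_poly fls_const p) (a - fls_const c) = 0" using assms(2) by (simp add: p_def)
    moreover have "p \<noteq> 0" using assms(1) by (simp add: p_def pcompose_eq_0_iff)
    moreover have "fls_subdegree (a - fls_const c) > 0 \<or> a - fls_const c = 0"
    proof -
      have "(a - fls_const c) $$ i = 0" if "i < 1" for i
        using that True by (cases "i = 0") (auto simp: c_def)
      then show ?thesis using val_ge_iff[of "a - fls_const c" 1] by (auto simp: val_ge_def)
    qed
    ultimately have "a - fls_const c = 0" using pos by blast
    then show ?thesis using that by simp
  next
    case False
    then have "fls_subdegree a < 0" by auto
    then show ?thesis using poly_fls_const_pole(1)[OF assms(1)] assms(2) by simp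
  qed
qed

section \<open>The degree estimate\<close>

text \<open>Bezout provides \<open>\<alpha>\<close> and \<open>\<beta>\<close>. The orders
  \<open>g * f\<close> and \<open>g * e\<close> turn into
  \<open>g * (\<alpha> * f - \<beta> * e) = g\<close> and 0, so that one monomial change stands for
  a whole chain of blow-ups.\<close>

lemma monomial_coordinates:
  assumes "u \<noteq> 0" "w \<noteq> 0" "fls_subdegree u = int (g * f)" "fls_subdegree w = int (g * e)"
    and "coprime f e" "f > 0"
  obtains \<alpha> \<beta> s z where "s \<noteq> 0" "z \<noteq> 0" "fls_subdegree s = int g" "fls_subdegree z = 0"
    "\<alpha> * f = \<beta> * e + 1" "s ^ f * z ^ \<beta> = u" "s ^ e * z ^ \<alpha> = w"
    "bracket s z * (u * w) = s * z * bracket u w" "z = w ^ f / u ^ e"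
proof -
  obtain \<alpha> \<beta> where ab: "\<alpha> * f = \<beta> * e + 1"
    using bezout_nat[of f e] assms(5,6) by (auto simp: mult.commute)
  define s z where "s = u ^ \<alpha> / w ^ \<beta>" and "z = w ^ f / u ^ e"
  have sz: "s \<noteq> 0" "z \<noteq> 0" using assms by (simp_all add: s_def z_def)
  have uw: "s ^ f * z ^ \<beta> = u" "s ^ e * z ^ \<alpha> = w"
    using monomial_change[OF ab assms(1,2)] by (simp_all add: s_def z_def)
  have "fls_subdegree s = int g * (int (\<alpha> * f) - int (\<beta> * e))"
    using assms by (simp add: s_def subdegree_divide subdegree_power algebra_simps)
  then have "fls_subdegree s = int g" by (simp add: ab)
  moreover have "fls_subdegree z = 0"
    using assms by (simp add: z_def subdegree_divide subdegree_power algebra_simps)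
  moreover have "bracket s z * (u * w) = s * z * bracket u w"
    using bracket_monomial[OF ab sz] by (simp add: uw)
  ultimately show ?thesis using that sz ab uw z_def by blast
qed

lemma eval1_pcompose_shift: "eval1 w (pcompose q [:c, 1:]) = eval1 (cst c + w) q"
  by (induction q) (simp_all add: pcompose_pCons eval1_add eval1_mult eval1_smult algebra_simps)

lemma eval2_map_pcompose_shift:
  "eval2 s w (map_poly (\<lambda>q. pcompose q [:c, 1:]) H) = eval2 s (cst c + w) H"
  by (induction H) (simp_all add: map_poly_pCons eval1_pcompose_shift)

lemma pcompose_power: "pcompose (p ^ n) q = pcompose p q ^ n"
  for p q :: "'b::comm_ring_1 poly"
  by (induction n) (simp_all add: pcompose_mult pcompose_1)

text \<open>Moving the root \<open>c\<close> to 0 turns its multiplicity into the lowest exponent.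
  The coefficient there is the value at \<open>c\<close> of the cofactor, which is nonzero.\<close>

lemma coeff_pcompose_shift_order:
  fixes q :: "'b::field poly"
  assumes "q \<noteq> 0"
  shows "coeff (pcompose q [:c, 1:]) (order c q) \<noteq> 0"
proof -
  obtain r where q: "q = [:- c, 1:] ^ order c q * r" and "\<not> [:- c, 1:] dvd r"
    using order_decomp[OF assms] by blast
  then have r: "poly r c \<noteq> 0" by (simp add: poly_eq_0_iff_dvd)
  have "pcompose [:- c, 1:] [:c, 1:] = monom 1 1"
    by (simp add: pcompose_pCons monom_altdef)
  then have "pcompose q [:c, 1:] = monom 1 (order c q) * pcompose r [:c, 1:]"
    by (subst q) (simp add: pcompose_mult pcompose_power monom_power)
  moreover have "coeff (pcompose r [:c, 1:]) 0 = poly r c"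
    by (simp add: poly_pcompose flip: poly_0_coeff_0)
  ultimately show ?thesis using r by (simp add: coeff_monom_mult)
qed

text \<open>On the line of weight \<open>W\<close>, the exponent of the coordinate \<open>z\<close>
  is an affine function of \<open>j\<close> with slope \<open>1/f\<close>. This yields both the
  injectivity and the width needed for edge polynomials.\<close>

lemma line_parametrization:
  fixes \<alpha> \<beta> e f i j :: nat
  assumes "\<alpha> * f = \<beta> * e + 1" "f * i + e * j = W"
  shows "f * (\<alpha> * j + \<beta> * i) = j + \<beta> * W"
proof -
  have "f * (\<alpha> * j + \<beta> * i) = (\<alpha> * f) * j + \<beta> * (f * i)" by (simp add: algebra_simps)
  also have "\<dots> = j + \<beta> * W" unfolding assms(1) assms(2)[symmetric] by (simp add: algebra_simps)
  finally show ?thesis .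
qed

lemma line_inj_on:
  fixes \<alpha> \<beta> e f :: nat
  assumes "\<alpha> * f = \<beta> * e + 1" "f > 0"
  shows "inj_on (\<lambda>p. \<alpha> * snd p + \<beta> * fst p) {p. f * fst p + e * snd p = W}"
proof (rule inj_onI)
  fix p q assume *: "p \<in> {p. f * fst p + e * snd p = W}" "q \<in> {p. f * fst p + e * snd p = W}"
    "\<alpha> * snd p + \<beta> * fst p = \<alpha> * snd q + \<beta> * fst q"
  then have "snd p = snd q"
    using line_parametrization[OF assms(1), of "fst p" "snd p" W] line_parametrization[OF assms(1), of "fst q" "snd q" W]
    by simp
  moreover have "f * fst p + e * snd p = f * fst q + e * snd q" using *(1,2) by simp
  then have "f * fst p = f * fst q" using calculation by simp
  ultimately show "p = q" using assms(2) by (simp add: prod_eq_iff)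
qed

text \<open>Induction on \<open>\<omega>\<close>, the order of the bracket minus that of
  \<open>s\<close>. If the residue of \<open>z\<close> is no root of \<open>H(0, z)\<close>, nothing
  cancels. Otherwise \<open>z = c + w\<close>, and a monomial change of \<open>(s, w)\<close>
  extracts a power of \<open>s'\<close> of order at most \<open>k * ord w\<close>, while
  \<open>\<omega>\<close> drops by exactly \<open>ord w\<close>. The nonzero roots of the new edge
  polynomial again have multiplicity at most \<open>k\<close>.\<close>

lemma eval2_subdegree_le:
  assumes "fls_subdegree s > 0" "z \<noteq> 0" "fls_subdegree z = 0" "coeff H 0 \<noteq> 0"
    and "\<And>c. c \<noteq> 0 \<Longrightarrow> order c (coeff H 0) \<le> k" "bracket s z \<noteq> 0"
  shows "eval2 s z H \<noteq> 0 \<and>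
    fls_subdegree (eval2 s z H) \<le> int k * (fls_subdegree (bracket s z) - fls_subdegree s)"
  using assms
proof (induction "nat (fls_subdegree (bracket s z) - fls_subdegree s)" arbitrary: s z H k rule: less_induct)
  case less
  define \<omega> where "\<omega> = fls_subdegree (bracket s z) - fls_subdegree s"
  have s0: "s \<noteq> 0" using less.prems(1) by auto
  have \<omega>: "\<omega> \<ge> 0" using subdegree_bracket[OF less.prems(6)] less.prems(3) by (simp add: \<omega>_def)
  have vz: "val_ge z 0" "val_ge s 1" using less.prems s0 by (simp_all add: val_ge_iff)
  note H0 = eval2_val_ge_0[OF vz, of H]
  show ?case
  proof (cases "poly (map_poly fls_const (coeff H 0)) (z $$ 0) = 0")
    case False
    then have "eval2 s z H $$ 0 \<noteq> 0" using H0 by simp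
    then have "eval2 s z H \<noteq> 0" "fls_subdegree (eval2 s z H) \<le> 0"
      by (auto intro: fls_subdegree_leI)
    then show ?thesis using \<omega> unfolding \<omega>_def[symmetric]
      by (meson mult_nonneg_nonneg of_nat_0_le_iff order_trans)
  next
    case True
    obtain c where c: "z $$ 0 = fls_const c" by (rule poly_fls_const_root[OF less.prems(4) True])
    have "z $$ 0 \<noteq> 0" using less.prems(2,3) by (metis nth_fls_subdegree_nonzero)
    then have c0: "c \<noteq> 0" using c by auto
    define w where "w = z - cst c"
    have z: "z = cst c + w" by (simp add: w_def)
    have br: "bracket s w = bracket s z"
      unfolding z by (simp add: derivationD[OF derivation_bracket])
    have w0: "w \<noteq> 0" using br less.prems(6) derivationD(4)[OF derivation_bracket, of s] by auto
    have "val_ge w 1"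
      unfolding val_ge_def
    proof (intro allI impI)
      fix i :: int assume "i < 1"
      then show "w $$ i = 0"
        using vz(1) c by (cases "i = 0") (auto simp: w_def val_ge_def cst_def)
    qed
    then have vw: "fls_subdegree w > 0" using w0 by (simp add: val_ge_iff)
    define G where "G = map_poly (\<lambda>q. pcompose q [:c, 1:]) H"
    define k0 where "k0 = order c (coeff H 0)"
    \<comment> \<open>The pure power \<open>w ^ k0\<close>, with \<open>k0\<close> the multiplicity
      of the root \<open>c\<close>, occurs in \<open>G\<close>. It bounds the minimal weight by
      \<open>e * k0\<close>.\<close>
    have k0: "coeff (coeff G 0) k0 \<noteq> 0" "k0 \<le> k"
      using coeff_pcompose_shift_order[OF less.prems(4)] less.prems(5)[OF c0]
      by (simp_all add: G_def k0_def coeff_map_poly)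
    have ev: "eval2 s z H = eval2 s w G"
      unfolding G_def z eval2_map_pcompose_shift by simp
    define g where "g = gcd (nat (fls_subdegree s)) (nat (fls_subdegree w))"
    have gpos: "g > 0" using less.prems(1) by (simp add: g_def)
    obtain f e where fe: "nat (fls_subdegree s) = f * g" "nat (fls_subdegree w) = e * g" "coprime f e"
      using gcd_coprime_exists[of "nat (fls_subdegree s)" "nat (fls_subdegree w)"] gpos
      unfolding g_def[symmetric] by blast
    have sub: "fls_subdegree s = int (g * f)" "fls_subdegree w = int (g * e)"
      using fe(1,2) less.prems(1) vw unfolding mult.commute[of g] by linarith+
    have f0: "f > 0" using fe(1) less.prems(1) by (cases f) auto
    obtain \<alpha> \<beta> s' z' where n: "s' \<noteq> 0" "z' \<noteq> 0" "fls_subdegree s' = int g" "fls_subdegree z' = 0"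
      "\<alpha> * f = \<beta> * e + 1" "s' ^ f * z' ^ \<beta> = s" "s' ^ e * z' ^ \<alpha> = w"
      "bracket s' z' * (s * w) = s' * z' * bracket s w"
      using monomial_coordinates[OF s0 w0 sub fe(3) f0] by metis
    \<comment> \<open>In the new coordinates \<open>s ^ i * w ^ j\<close> contains \<open>s'\<close>
      with exponent \<open>f * i + e * j\<close>. The smallest such exponent on the support gives
      the common factor \<open>s' ^ W\<close>.\<close>
    define W where "W = Min ((\<lambda>p. f * fst p + e * snd p) ` supp G)"
    have k0G: "(0, k0) \<in> supp G" using k0 by (simp add: supp_def)
    have Wle: "W \<le> f * fst p + e * snd p" if "p \<in> supp G" for p
      using that by (simp add: W_def)
    have "W \<in> (\<lambda>p. f * fst p + e * snd p) ` supp G"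
      unfolding W_def using k0G by (intro Min_in) (auto simp del: supp_empty_iff)
    then obtain p0 where p0: "p0 \<in> supp G" "f * fst p0 + e * snd p0 = W" by auto
    have Wk: "W \<le> e * k0" using Wle[OF k0G] by simp
    define H' where "H' = (\<Sum>p\<in>supp G. monom (monom (coeff (coeff G (fst p)) (snd p))
      (\<alpha> * snd p + \<beta> * fst p)) (f * fst p + e * snd p - W))"
    have "eval2 s w G = (\<Sum>p\<in>supp G. s' ^ W * (cst (coeff (coeff G (fst p)) (snd p)) *
      z' ^ (\<alpha> * snd p + \<beta> * fst p) * s' ^ (f * fst p + e * snd p - W)))"
      unfolding eval2_eq_sum_supp
    proof (rule sum.cong)
      fix p assume p: "p \<in> supp G"
      have "s ^ fst p * w ^ snd p = s' ^ (f * fst p + e * snd p) * z' ^ (\<alpha> * snd p + \<beta> * fst p)"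
        unfolding n(6,7)[symmetric] by (simp add: power_add power_mult power_mult_distrib mult_ac)
      also have "s' ^ (f * fst p + e * snd p) = s' ^ W * s' ^ (f * fst p + e * snd p - W)"
        using Wle[OF p] by (simp flip: power_add)
      finally show "cst (coeff (coeff G (fst p)) (snd p)) * s ^ fst p * w ^ snd p =
          s' ^ W * (cst (coeff (coeff G (fst p)) (snd p)) *
      z' ^ (\<alpha> * snd p + \<beta> * fst p) * s' ^ (f * fst p + e * snd p - W))"
        by (simp add: mult_ac)
    qed simp
    then have ev': "eval2 s w G = s' ^ W * eval2 s' z' H'"
      by (simp add: H'_def eval2_sum sum_distrib_left)
    \<comment> \<open>Only the monomials on the edge of weight \<open>W\<close> survive at
      \<open>s' = 0\<close>.\<close>
    define L where "L = {p \<in> supp G. f * fst p + e * snd p = W}"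
    have "coeff H' 0 = (\<Sum>p\<in>supp G. if f * fst p + e * snd p = W then monom (coeff (coeff G (fst p)) (snd p))
      (\<alpha> * snd p + \<beta> * fst p) else 0)"
      unfolding H'_def coeff_sum by (rule sum.cong) (use Wle in \<open>force+\<close>)
    also have "\<dots> = (\<Sum>p\<in>L. monom (coeff (coeff G (fst p)) (snd p)) (\<alpha> * snd p + \<beta> * fst p))"
      by (simp add: L_def sum.inter_filter)
    finally have H'0: "coeff H' 0 = (\<Sum>p\<in>L. monom (coeff (coeff G (fst p)) (snd p)) (\<alpha> * snd p + \<beta> * fst p))" .
    have p0L: "p0 \<in> L" using p0 by (simp add: L_def)
    have L: "finite L" "L \<noteq> {}" "inj_on (\<lambda>p. \<alpha> * snd p + \<beta> * fst p) L"
    proof -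
      show "inj_on (\<lambda>p. \<alpha> * snd p + \<beta> * fst p) L"
        by (rule inj_on_subset[OF line_inj_on[OF n(5) f0, of W]]) (auto simp: L_def)
      show "L \<noteq> {}" using p0L by blast
    qed (simp add: L_def)
    have Lc: "coeff (coeff G (fst p)) (snd p) \<noteq> 0" if "p \<in> L" for p
      using that by (auto simp: L_def supp_def)
    \<comment> \<open>An edge point has \<open>e * snd p \<le> W \<le> e * k0\<close>, and the
      exponent of \<open>z'\<close> varies with \<open>snd p\<close> at slope \<open>1/f\<close>, so
      the width is at most \<open>k0\<close>.\<close>
    have Lk: "\<alpha> * snd p + \<beta> * fst p \<le> \<alpha> * snd q + \<beta> * fst q + k0" if "p \<in> L" "q \<in> L" for p q
    proof -
      have e0: "e > 0" using sub(2) vw by (cases e) auto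
      have "e * snd p \<le> W" using that(1) by (auto simp: L_def)
      then have "e * snd p \<le> e * k0" using Wk by (rule order_trans)
      then have "snd p \<le> k0" using e0 by simp
      then have "f * (\<alpha> * snd p + \<beta> * fst p) \<le> f * (\<alpha> * snd q + \<beta> * fst q) + k0"
        using that line_parametrization[OF n(5), of "fst p" "snd p" W] line_parametrization[OF n(5), of "fst q" "snd q" W]
        by (simp add: L_def)
      also have "\<dots> \<le> f * (\<alpha> * snd q + \<beta> * fst q + k0)"
        using f0 by (simp add: distrib_left)
      finally show ?thesis using f0 by simp
    qed
    have H'nz: "coeff H' 0 \<noteq> 0"
      unfolding H'0 by (rule sum_monom_order_le(1)[OF L, where k = "k0"]) (fact Lc Lk)+
    have H'ord: "order a (coeff H' 0) \<le> k0" if "a \<noteq> 0" for a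
      unfolding H'0 by (rule sum_monom_order_le(2)[OF L, where k = "k0"]) (fact Lc Lk that)+
    have br': "bracket s' z' \<noteq> 0"
      using n(8) n(1,2) less.prems(6) br by auto
    have "fls_subdegree (bracket s' z' * (s * w)) = fls_subdegree (s' * z' * bracket s z)"
      using n(8) br by simp
    \<comment> \<open>Compare orders in the invariance of the logarithmic form: \<open>z'\<close>
      has order 0 and the translation by \<open>c\<close> does not change the bracket.\<close>
    then have \<omega>': "fls_subdegree (bracket s' z') - fls_subdegree s' = \<omega> - fls_subdegree w"
      using br' n(1-4) s0 w0 less.prems(6) by (simp add: \<omega>_def)
    have \<omega>w: "\<omega> \<ge> fls_subdegree w"
      using subdegree_bracket[of s w] less.prems(6) br by (simp add: \<omega>_def)
    have "nat (fls_subdegree (bracket s' z') - fls_subdegree s') < nat (fls_subdegree (bracket s z) - fls_subdegree s)"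
      using \<omega>' \<omega>w vw unfolding \<omega>_def by linarith
    then have IH: "eval2 s' z' H' \<noteq> 0" "fls_subdegree (eval2 s' z' H') \<le> int k0 * (\<omega> - fls_subdegree w)"
      using less.hyps[of s' z' H' k0] n gpos H'nz H'ord br' \<omega>' by auto
    have nz: "eval2 s z H \<noteq> 0" using ev ev' IH(1) n(1) by simp
    have "fls_subdegree (eval2 s z H) = int W * int g + fls_subdegree (eval2 s' z' H')"
      using ev ev' IH(1) n(1,3) by (simp add: subdegree_power)
    also have "int W * int g \<le> int k0 * fls_subdegree w"
      using mult_right_mono[OF Wk, of g] sub(2)
      by (simp add: algebra_simps flip: of_nat_mult)
    also have "int k0 * fls_subdegree w + fls_subdegree (eval2 s' z' H') \<le> int k0 * \<omega>"
      using IH(2) by (simp add: algebra_simps)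
    also have "\<dots> \<le> int k * \<omega>"
      using k0(2) \<omega> by (simp add: mult_right_mono)
    finally show ?thesis using nz by (simp add: \<omega>_def)
  qed
qed

text \<open>
  Here \<open>P\<close> and \<open>Q\<close> have poles of orders \<open>g * f\<close> and \<open>g * e\<close>, and \<open>N\<close> is the weighted degree of \<open>F\<close>.
  The number of lattice points on the top edge of \<open>F\<close> bounds the possible cancellation; each
  cancellation is worth at most the defect of the bracket.
\<close>

lemma eval2_pole_bound:
  assumes "P \<noteq> 0" "Q \<noteq> 0" "fls_subdegree P = - int (g * f)" "fls_subdegree Q = - int (g * e)"
    and "coprime f e" "f > 0" "e > 0" "g > 0" "bracket P Q \<noteq> 0" "F \<noteq> 0"
  defines "N \<equiv> Max ((\<lambda>p. f * fst p + e * snd p) ` supp F)"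
  shows "eval2 P Q F \<noteq> 0"
    and "fls_subdegree (eval2 P Q F) \<le> - int (g * N) +
      int (N div (e * f)) * (fls_subdegree (bracket P Q) + int (g * f) + int (g * e))"
    and "(\<And>c. (P ^ e / Q ^ f) $$ 0 \<noteq> fls_const c) \<Longrightarrow> fls_subdegree (eval2 P Q F) = - int (g * N)"
proof -
  \<comment> \<open>Inverses turn the poles into zeros, so that \<open>monomial_coordinates\<close>
    applies.\<close>
  define u w where "u = inverse P" and "w = inverse Q"
  have uw: "u \<noteq> 0" "w \<noteq> 0" "fls_subdegree u = int (g * f)" "fls_subdegree w = int (g * e)"
    using assms by (simp_all add: u_def w_def)
  have PQ: "P = inverse u" "Q = inverse w" by (simp_all add: u_def w_def)
  \<comment> \<open>Inversion changes the sign of the logarithmic derivative; inverting both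
    arguments leaves \<open>dP/P \<and> dQ/Q\<close> unchanged.\<close>
  have dinv: "\<delta> a * inverse a = - (a * \<delta> (inverse a))" if "derivation \<delta>" "a \<noteq> 0" for \<delta> and a :: "'a fls fls"
    using derivationD(2)[OF that(1), of a "inverse a"] derivationD(5)[OF that(1)] that(2)
    by (simp add: algebra_simps eq_neg_iff_add_eq_0)
  have bruw: "bracket u w * (P * Q) = u * w * bracket P Q"
  proof -
    have "bracket u w * P * Q = - (u * bracket P w) * Q"
      using dinv[OF derivation_bracket_left uw(1), of w] by (simp add: PQ)
    also have "\<dots> = - u * (bracket P w * Q)" by simp
    also have "bracket P w * Q = - (w * bracket P Q)"
      using dinv[OF derivation_bracket uw(2), of P] by (simp add: PQ)
    finally show ?thesis by (simp add: algebra_simps)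
  qed
  obtain \<alpha> \<beta> s z where n: "s \<noteq> 0" "z \<noteq> 0" "fls_subdegree s = int g" "fls_subdegree z = 0"
      "\<alpha> * f = \<beta> * e + 1" "s ^ f * z ^ \<beta> = u" "s ^ e * z ^ \<alpha> = w"
      "bracket s z * (u * w) = s * z * bracket u w" "z = w ^ f / u ^ e"
    using monomial_coordinates[OF uw assms(5,6)] by metis
  have zPQ: "z = P ^ e / Q ^ f"
    using n(9) uw by (simp add: PQ field_simps)
  have bruw0: "bracket u w \<noteq> 0" using bruw assms uw by auto
  have br0: "bracket s z \<noteq> 0" using n(8) n(1,2) bruw0 by auto
  have "fls_subdegree (bracket u w * (P * Q)) = fls_subdegree (u * w * bracket P Q)"
    using bruw by simp
  moreover have "fls_subdegree (bracket s z * (u * w)) = fls_subdegree (s * z * bracket u w)"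
    using n(8) by simp
  ultimately have \<omega>: "fls_subdegree (bracket s z) - fls_subdegree s =
      fls_subdegree (bracket P Q) + int (g * f) + int (g * e)"
    using br0 bruw0 uw n(1-4) assms(1-4,9) by simp
  define t where "t p = \<alpha> * snd p + \<beta> * fst p" for p :: "nat \<times> nat"
  define d where "d p = f * fst p + e * snd p" for p :: "nat \<times> nat"
  define M where "M = Max (t ` supp F)"
  have M: "t p \<le> M" if "p \<in> supp F" for p using that by (simp add: M_def)
  have N: "d p \<le> N" if "p \<in> supp F" for p using that by (simp add: N_def d_def)
  have "N \<in> (\<lambda>p. f * fst p + e * snd p) ` supp F"
    unfolding N_def using assms(10) by (intro Max_in) auto
  then obtain p0 where p0: "p0 \<in> supp F" "d p0 = N" by (auto simp: d_def)
  define co where "co p = coeff (coeff F (fst p)) (snd p)" for p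
  \<comment> \<open>Multiplication by \<open>s ^ N * z ^ M\<close> makes all exponents natural
    numbers. The monomials of top weight \<open>N\<close> become the part of \<open>H\<close> free
    of \<open>s\<close>.\<close>
  define H where "H = (\<Sum>p\<in>supp F. monom (monom (co p) (M - t p)) (N - d p))"
  have "eval2 P Q F * (s ^ N * z ^ M) = (\<Sum>p\<in>supp F. cst (co p) * z ^ (M - t p) * s ^ (N - d p))"
    unfolding eval2_eq_sum_supp sum_distrib_right
  proof (rule sum.cong)
    fix p assume p: "p \<in> supp F"
    have "s ^ d p * z ^ t p = u ^ fst p * w ^ snd p"
      unfolding n(6,7)[symmetric] d_def t_def
      by (simp add: power_add power_mult power_mult_distrib mult_ac)
    then have "P ^ fst p * Q ^ snd p * (s ^ d p * z ^ t p) = 1"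
      using uw by (simp add: PQ field_simps)
    moreover have "s ^ N = s ^ d p * s ^ (N - d p)" "z ^ M = z ^ t p * z ^ (M - t p)"
      using N[OF p] M[OF p] by (simp_all flip: power_add)
    ultimately show "cst (coeff (coeff F (fst p)) (snd p)) * P ^ fst p * Q ^ snd p * (s ^ N * z ^ M) =
        cst (co p) * z ^ (M - t p) * s ^ (N - d p)"
      by (simp add: co_def mult_ac)
  qed simp
  also have "\<dots> = eval2 s z H" by (simp add: H_def eval2_sum)
  finally have ev: "eval2 P Q F * (s ^ N * z ^ M) = eval2 s z H" .
  define L where "L = {p \<in> supp F. d p = N}"
  have "coeff H 0 = (\<Sum>p\<in>supp F. if d p = N then monom (co p) (M - t p) else 0)"
    unfolding H_def coeff_sum by (rule sum.cong) (use N in \<open>force+\<close>)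
  also have "\<dots> = (\<Sum>p\<in>L. monom (co p) (M - t p))"
    by (simp add: L_def sum.inter_filter)
  finally have H0: "coeff H 0 = (\<Sum>p\<in>L. monom (co p) (M - t p))" .
  have inj: "inj_on t L"
    unfolding t_def by (rule inj_on_subset[OF line_inj_on[OF n(5) assms(6), of N]]) (auto simp: L_def d_def)
  have L: "finite L" "L \<noteq> {}" "inj_on (\<lambda>p. M - t p) L"
  proof -
    show "inj_on (\<lambda>p. M - t p) L"
    proof (rule inj_onI)
      fix p q assume *: "p \<in> L" "q \<in> L" "M - t p = M - t q"
      then have "t p \<le> M" "t q \<le> M" using M by (auto simp: L_def)
      then have "t p = t q" using *(3) by linarith
      then show "p = q" using inj * by (auto dest: inj_onD)
    qed
    have "p0 \<in> L" using p0 by (simp add: L_def)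
    then show "L \<noteq> {}" by blast
  qed (simp add: L_def)
  have Lc: "co p \<noteq> 0" if "p \<in> L" for p
    using that by (auto simp: L_def supp_def co_def)
  \<comment> \<open>On the top edge \<open>f * (t q - t p) \<le> snd q\<close> and
    \<open>e * snd q \<le> N\<close>. The difference of exponents is an integer, so the quotient may
    be rounded down.\<close>
  have Lk: "M - t p \<le> M - t q + N div (e * f)" if "p \<in> L" "q \<in> L" for p q
  proof -
    have 1: "f * t q = snd q + \<beta> * N" "f * t p = snd p + \<beta> * N"
      using that line_parametrization[OF n(5)] by (auto simp: L_def t_def d_def)
    have 2: "e * snd q \<le> N" using that(2) by (auto simp: L_def d_def)
    have "f * (t q - t p) \<le> snd q" using 1 by (simp add: diff_mult_distrib2)
    then have "e * (f * (t q - t p)) \<le> e * snd q" by (rule mult_le_mono2)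
    then have "e * (f * (t q - t p)) \<le> N" using 2 by (rule order_trans)
    then have "(t q - t p) * (e * f) \<le> N" by (simp add: mult_ac)
    then have "t q - t p \<le> N div (e * f)"
      using assms(6,7) by (simp add: less_eq_div_iff_mult_less_eq)
    moreover have "t q \<le> M" using that M by (auto simp: L_def)
    ultimately show ?thesis by linarith
  qed
  have Hnz: "coeff H 0 \<noteq> 0"
    unfolding H0 by (rule sum_monom_order_le(1)[OF L, where k = "N div (e * f)"]) (fact Lc Lk)+
  have Hord: "order a (coeff H 0) \<le> N div (e * f)" if "a \<noteq> 0" for a
    unfolding H0 by (rule sum_monom_order_le(2)[OF L, where k = "N div (e * f)"]) (fact Lc Lk that)+
  have b: "eval2 s z H \<noteq> 0" "fls_subdegree (eval2 s z H) \<le>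
      int (N div (e * f)) * (fls_subdegree (bracket P Q) + int (g * f) + int (g * e))"
    using eval2_subdegree_le[of s z H "N div (e * f)"] n(2,3,4) assms(8) Hnz Hord br0 \<omega> by auto
  show nz: "eval2 P Q F \<noteq> 0" using b(1) ev by auto
  have "fls_subdegree (eval2 P Q F * (s ^ N * z ^ M)) = fls_subdegree (eval2 s z H)" by (simp add: ev)
  then have sub: "fls_subdegree (eval2 P Q F) = - int (g * N) + fls_subdegree (eval2 s z H)"
    using nz n(1-4) by (simp add: subdegree_power mult.commute)
  show "fls_subdegree (eval2 P Q F) \<le> - int (g * N) +
      int (N div (e * f)) * (fls_subdegree (bracket P Q) + int (g * f) + int (g * e))"
    using sub b(2) by simp
  \<comment> \<open>A residue of \<open>z\<close> outside \<open>K\<close> is no root of the edge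
    polynomial, so nothing cancels.\<close>
  assume nc: "\<And>c. (P ^ e / Q ^ f) $$ 0 \<noteq> fls_const c"
  have vz: "val_ge z 0" "val_ge s 1" using n(1-4) assms(8) by (simp_all add: val_ge_iff)
  note e0 = eval2_val_ge_0[OF vz, of H]
  have "poly (map_poly fls_const (coeff H 0)) (z $$ 0) \<noteq> 0"
    using poly_fls_const_root[OF Hnz] nc zPQ by metis
  then have "eval2 s z H $$ 0 \<noteq> 0" using e0 by simp
  then have "fls_subdegree (eval2 s z H) = 0"
    using e0(1) by (intro fls_subdegree_eqI) (auto simp: val_ge_def)
  then show "fls_subdegree (eval2 P Q F) = - int (g * N)" using sub by simp
qed

section \<open>Polynomials and their degree\<close>

definition emb :: "'a::field poly poly \<Rightarrow> 'a fls fls" where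
  "emb = eval2 fls_X_inv (fls_const fls_X * fls_X_inv)"

text \<open>\<open>x ^ i * y ^ j\<close> goes to \<open>\<tau> ^ j / \<xi> ^ (i + j)\<close>.
  Distinct monomials stay distinct, and the pole order in \<open>\<xi>\<close> is the total
  degree.\<close>

lemma emb_nth: "emb p $$ (- int d) $$ int j = (if j \<le> d then coeff (coeff p (d - j)) j else 0)"
proof -
  have "emb p $$ (- int d) $$ int j = (\<Sum>q\<in>supp p. if q = (d - j, j) then if j \<le> d then coeff (coeff p (d - j)) j else 0 else 0)"
    unfolding emb_def eval2_eq_sum_supp fls_nth_sum
  proof (rule sum.cong)
    fix q assume "q \<in> supp p"
    have "cst (coeff (coeff p (fst q)) (snd q)) * fls_X_inv ^ fst q * (fls_const fls_X * fls_X_inv) ^ snd q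
      = fls_const (fls_const (coeff (coeff p (fst q)) (snd q)) * fls_X ^ snd q) * fls_X_inv ^ (fst q + snd q)"
      by (simp add: cst_def power_add power_mult_distrib fls_const_power flip: fls_const_mult_const)
    then show "(cst (coeff (coeff p (fst q)) (snd q)) * fls_X_inv ^ fst q * (fls_const fls_X * fls_X_inv) ^ snd q)
        $$ (- int d) $$ int j = (if q = (d - j, j) then if j \<le> d then coeff (coeff p (d - j)) j else 0 else 0)"
      by (cases q) auto
  qed simp
  also have "\<dots> = (if j \<le> d then coeff (coeff p (d - j)) j else 0)"
    by (subst sum.delta, rule finite_supp) (auto simp: supp_def)
  finally show ?thesis .
qed

lemma val_ge_emb: "val_ge (emb p) (- int d) \<Longrightarrow> i + j > d \<Longrightarrow> coeff (coeff p i) j = 0"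
  using emb_nth[of p "i + j" j] by (simp add: val_ge_def)

lemma emb_0 [simp]: "emb 0 = 0"
  by (simp add: emb_def)

lemma emb_eq_0_iff [simp]: "emb p = 0 \<longleftrightarrow> p = 0"
proof
  assume "emb p = 0"
  then have "coeff (coeff p i) j = 0" for i j
    using emb_nth[of p "i + j" j] by simp
  then show "p = 0" by (simp add: poly_eq_iff)
qed simp

lemma emb_subdegree_le_0: "fls_subdegree (emb p) \<le> 0"
proof (cases "p = 0")
  case False
  then obtain i j where "coeff (coeff p i) j \<noteq> 0" by (auto simp: poly_eq_iff)
  then have "emb p $$ (- int (i + j)) \<noteq> 0"
    using emb_nth[of p "i + j" j] by auto
  then show ?thesis by (auto dest: fls_subdegree_leI)
qed (simp add: emb_def)

lemma emb_add: "emb (p + q) = emb p + emb q"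
  and emb_mult: "emb (p * q) = emb p * emb q"
  and emb_Const [simp]: "emb (Const c) = cst c"
  and emb_subst: "emb (subst p f) = eval2 (emb (fst f)) (emb (snd f)) p"
  by (simp_all add: emb_def eval2_add eval2_mult eval2_subst)

lemma emb_eval_y: "emb (eval_y q p) = eval1 (emb p) q"
  by (simp add: emb_def eval2_eval_y)

lemma emb_var: "emb var_x = fls_X_inv" "emb var_y = fls_const fls_X * fls_X_inv"
  by (simp_all add: emb_def)

lemma Const_uminus: "Const (- a) = - Const a"
  by (simp add: Const_def)

lemma coeff_linear_form:
  "coeff (coeff (Const a * var_x + Const b * var_y + Const c) i) j =
    (if i = 1 \<and> j = 0 then a else if i = 0 \<and> j = 1 then b else if i = 0 \<and> j = 0 then c else 0)"
  by (auto simp: Const_def var_x_def var_y_def coeff_pCons split: nat.split)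

lemma linear_form_eq_iff:
  "Const a * var_x + Const b * var_y + Const c = Const a' * var_x + Const b' * var_y + Const c' \<longleftrightarrow>
    a = a' \<and> b = b' \<and> c = c'" (is "?l = ?r \<longleftrightarrow> _")
proof
  assume "?l = ?r"
  then have "coeff (coeff ?l i) j = coeff (coeff ?r i) j" for i j by simp
  from this[of 1 0] this[of 0 1] this[of 0 0] show "a = a' \<and> b = b' \<and> c = c'"
    unfolding coeff_linear_form by simp
qed simp

lemma linear_formI:
  assumes "\<And>i j. i + j > 1 \<Longrightarrow> coeff (coeff p i) j = 0"
  obtains a b c where "p = Const a * var_x + Const b * var_y + Const c"
proof
  show "p = Const (coeff (coeff p 1) 0) * var_x + Const (coeff (coeff p 0) 1) * var_y + Const (coeff (coeff p 0) 0)"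
  proof (intro poly_eqI)
    fix i j
    show "coeff (coeff p i) j = coeff (coeff (Const (coeff (coeff p 1) 0) * var_x +
        Const (coeff (coeff p 0) 1) * var_y + Const (coeff (coeff p 0) 0)) i) j"
      unfolding coeff_linear_form using assms[of i j] by auto
  qed
qed

lemma coeff_Const: "coeff (coeff (Const c) i) j = (if i = 0 \<and> j = 0 then c else 0)"
  by (auto simp: Const_def coeff_pCons split: nat.split)

lemma ConstI:
  assumes "\<And>i j. i + j > 0 \<Longrightarrow> coeff (coeff p i) j = 0"
  obtains c where "p = Const c"
proof
  show "p = Const (coeff (coeff p 0) 0)"
    by (intro poly_eqI) (use assms in \<open>auto simp: coeff_Const\<close>)
qed

lemma var_neq_Const: "var_x \<noteq> Const c" "var_y \<noteq> Const c"
  by (auto simp: var_x_def var_y_def Const_def)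

section \<open>Automorphisms\<close>

lemma carrier_GA2_iff: "f \<in> carrier GA2 \<longleftrightarrow> (\<exists>g. pcomp f g = pid \<and> pcomp g f = pid)"
  by (simp add: GA2_def)

lemma mult_GA2 [simp]: "mult GA2 = pcomp" and one_GA2 [simp]: "one GA2 = pid"
  by (simp_all add: GA2_def)

text \<open>The components of an automorphism are algebraically independent, because an inverse
  undoes the substitution.\<close>

lemma subst_eq_iff:
  assumes "f \<in> carrier GA2"
  shows "subst p f = subst q f \<longleftrightarrow> p = q"
proof
  obtain g where g: "pcomp f g = pid" using assms by (auto simp: carrier_GA2_iff simp del: split_paired_Ex)
  assume "subst p f = subst q f"
  then have "subst (subst p f) g = subst (subst q f) g" by simp
  then show "p = q" by (simp only: subst_pcomp[symmetric] g subst_pid)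
qed simp

lemma aut_neq_Const:
  assumes "f \<in> carrier GA2"
  shows "fst f \<noteq> Const c" "snd f \<noteq> Const c"
  using subst_eq_iff[OF assms, of var_x "Const c"] subst_eq_iff[OF assms, of var_y "Const c"] var_neq_Const
  by auto

lemma emb_subdegree_neg: "(\<And>c. p \<noteq> Const c) \<Longrightarrow> fls_subdegree (emb p) < 0"
proof (rule ccontr)
  assume p: "\<And>c. p \<noteq> Const c" and "\<not> fls_subdegree (emb p) < 0"
  then have v: "val_ge (emb p) (- int 0)" by (cases "p = 0") (auto simp: val_ge_iff)
  obtain c where "p = Const c" by (rule ConstI[OF val_ge_emb[OF v]])
  then show False using p by simp
qed

lemma aut_subdegree_neg:
  assumes "f \<in> carrier GA2"
  shows "fls_subdegree (emb (fst f)) < 0" "fls_subdegree (emb (snd f)) < 0"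
  using emb_subdegree_neg aut_neq_Const[OF assms] by metis+

lemma aut_emb_nz:
  assumes "f \<in> carrier GA2"
  shows "emb (fst f) \<noteq> 0" "emb (snd f) \<noteq> 0"
  using aut_subdegree_neg[OF assms] by auto

lemma bracket_xy: "bracket fls_X_inv (fls_const fls_X * fls_X_inv) = - (fls_X_inv * fls_X_inv :: 'a::field fls fls)"
proof -
  have 1: "coeff_deriv fls_X_inv = (0 :: 'a fls fls)" by (rule fls_eqI) simp
  have 2: "coeff_deriv (fls_const fls_X * fls_X_inv) = (fls_X_inv :: 'a fls fls)"
    by (rule fls_eqI) (simp add: if_distrib)
  have 3: "fls_X * fls_deriv fls_X_inv = - (fls_X_inv :: 'a fls fls)"
  proof -
    have "fls_X * fls_X_inv = (1 :: 'a fls fls)"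
      by (metis fls_inverse_X fls_X_nonzero right_inverse)
    then show ?thesis
      by (simp only: fls_deriv_X_inv power2_eq_square mult_minus_right mult.assoc[symmetric] mult_1_left)
  qed
  show ?thesis unfolding bracket_def 1 2 3 by simp
qed

text \<open>The chain rule works in both directions. Through an inverse, the bracket of
  \<open>x\<close> and \<open>y\<close> is a multiple of that of the components, which is therefore
  nonzero. Conversely the latter is a nonzero polynomial times the bracket of \<open>x\<close> and
  \<open>y\<close>, which has order -2.\<close>

lemma aut_bracket:
  assumes "f \<in> carrier GA2"
  shows "bracket (emb (fst f)) (emb (snd f)) \<noteq> 0"
    "fls_subdegree (bracket (emb (fst f)) (emb (snd f))) \<le> -2"
proof -
  let ?x = "fls_X_inv :: 'a fls fls" and ?y = "fls_const fls_X * fls_X_inv :: 'a fls fls"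
  obtain g where g: "pcomp g f = pid" using assms by (auto simp: carrier_GA2_iff simp del: split_paired_Ex)
  then have g': "eval2 (emb (fst f)) (emb (snd f)) (fst g) = ?x" "eval2 (emb (fst f)) (emb (snd f)) (snd g) = ?y"
    by (auto simp: pcomp_def pid_def emb_var simp flip: emb_subst)
  have xy: "bracket ?x ?y \<noteq> 0" by (simp add: bracket_xy)
  obtain D where "bracket ?x ?y = D * bracket (emb (fst f)) (emb (snd f))"
    using bracket_eval2[of "emb (fst f)" "emb (snd f)" "fst g" "snd g"] unfolding g' by blast
  then show nz: "bracket (emb (fst f)) (emb (snd f)) \<noteq> 0" using xy by auto
  obtain E where E: "bracket (emb (fst f)) (emb (snd f)) = emb E * bracket ?x ?y"
    using bracket_eval2[of ?x ?y "fst f" "snd f"] unfolding emb_def by blast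
  then have "E \<noteq> 0" using nz by auto
  then have "fls_subdegree (emb E * bracket ?x ?y) = fls_subdegree (emb E) + fls_subdegree (bracket ?x ?y)"
    using xy by simp
  also have "fls_subdegree (bracket ?x ?y) = -2" by (simp add: bracket_xy)
  finally show "fls_subdegree (bracket (emb (fst f)) (emb (snd f))) \<le> -2"
    using E emb_subdegree_le_0[of E] by simp
qed

text \<open>The pole bound is applied to a component \<open>G\<close> of an inverse: its value
  \<open>x\<close> or \<open>y\<close> has order exactly -1, and the bracket has order at most
  -2.\<close>

lemma aut_inverse_pole_bound:
  assumes "f \<in> carrier GA2" and G: "subst G f \<in> {var_x, var_y}"
    and deg: "fls_subdegree (emb (fst f)) = - int (g * m)" "fls_subdegree (emb (snd f)) = - int (g * e)"
    and "coprime m e" "m > 0" "e > 0" "g > 0"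
  defines "N \<equiv> Max ((\<lambda>p. m * fst p + e * snd p) ` supp G)"
  shows "-1 \<le> - int (g * N) + int (N div (e * m)) * (int (g * m) + int (g * e) - 2)"
    and "(\<And>c. (emb (fst f) ^ e / emb (snd f) ^ m) $$ 0 \<noteq> fls_const c) \<Longrightarrow> g * N = 1"
    and "\<exists>p \<in> supp G. p \<noteq> (0, 0)" and "\<And>p. p \<in> supp G \<Longrightarrow> m * fst p + e * snd p \<le> N"
proof -
  note nz = aut_emb_nz[OF assms(1)] and br = aut_bracket[OF assms(1)]
  have sub: "fls_subdegree (eval2 (emb (fst f)) (emb (snd f)) G) = -1"
    using G by (auto simp: emb_var simp flip: emb_subst)
  have G0: "G \<noteq> Const c" for c using G var_neq_Const[of c] by auto
  then have "G \<noteq> 0" by (metis Const_simps(1))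
  note b = eval2_pole_bound[OF nz deg assms(5-8) br(1) \<open>G \<noteq> 0\<close>, folded N_def]
  have "int (N div (e * m)) * (fls_subdegree (bracket (emb (fst f)) (emb (snd f))) + int (g * m) + int (g * e))
    \<le> int (N div (e * m)) * (int (g * m) + int (g * e) - 2)"
    using br(2) by (intro mult_left_mono) auto
  then show "-1 \<le> - int (g * N) + int (N div (e * m)) * (int (g * m) + int (g * e) - 2)"
    using b(2) sub by linarith
  show "g * N = 1" if "\<And>c. (emb (fst f) ^ e / emb (snd f) ^ m) $$ 0 \<noteq> fls_const c"
    using b(3)[OF that] sub by linarith
  show "\<exists>p \<in> supp G. p \<noteq> (0, 0)"
  proof (rule ccontr)
    assume *: "\<not> ?thesis"
    have co: "coeff (coeff G i) j = 0" if "i + j > 0" for i j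
      using * that by (force simp: supp_def)
    obtain c where "G = Const c" by (rule ConstI[OF co])
    then show False using G0 by simp
  qed
  show "m * fst p + e * snd p \<le> N" if "p \<in> supp G" for p
    using that by (simp add: N_def)
qed

text \<open>If \<open>m\<close> and \<open>e\<close> are at least 2, then
  \<open>e + m \<le> e * m\<close>. With \<open>k = N div (e * m)\<close>, the total loss of degree
  is at most \<open>g * N - 2 * k\<close>. A result of degree 1 forces \<open>k = 0\<close> and then
  \<open>g * N \<le> 1\<close>, although \<open>N \<ge> 2\<close>.\<close>

lemma aut_degree_dvd:
  assumes "f \<in> carrier GA2"
    and deg: "fls_subdegree (emb (fst f)) = - int (g * m)" "fls_subdegree (emb (snd f)) = - int (g * e)"
    and "coprime m e" "m > 0" "e > 0" "g > 0"
  shows "m = 1 \<or> e = 1"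
proof (rule ccontr)
  assume "\<not> ?thesis"
  then have me: "m \<ge> 2" "e \<ge> 2" using assms(5,6) by auto
  obtain h where h: "pcomp h f = pid" using assms(1) by (auto simp: carrier_GA2_iff simp del: split_paired_Ex)
  then have G: "subst (fst h) f \<in> {var_x, var_y}" by (auto simp: pcomp_def pid_def)
  note b = aut_inverse_pole_bound[OF assms(1) G deg assms(4-7)]
  define N where "N = Max ((\<lambda>p. m * fst p + e * snd p) ` supp (fst h))"
  define k where "k = N div (e * m)"
  have k: "k * (e * m) \<le> N" by (simp add: k_def)
  obtain p where p: "p \<in> supp (fst h)" "p \<noteq> (0, 0)" using b(3) by blast
  have "2 * fst p + 2 * snd p \<le> m * fst p + e * snd p" using me by (intro add_mono mult_right_mono) auto
  also have "\<dots> \<le> N" using b(4)[OF p(1)] by (simp add: N_def)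
  finally have N2: "2 \<le> N" using p(2) by (cases p) auto
  have "e + m \<le> e * m" using me by (metis add_mult_distrib mult_2 mult_le_mono add_le_mono le_trans mult.commute nat_mult_le_cancel_disj le_add1 le_add2 mult_le_mono2 nat_le_linear)
  then have "k * (g * (e + m)) \<le> k * (g * (e * m))" by simp
  also have "\<dots> \<le> g * N" using k by (simp add: mult_ac)
  finally have kN: "int k * (int (g * m) + int (g * e)) \<le> int (g * N)"
    by (simp add: algebra_simps flip: of_nat_mult of_nat_add)
  have "-1 \<le> - int (g * N) + int k * (int (g * m) + int (g * e) - 2)"
    using b(1) by (simp add: N_def k_def)
  also have "\<dots> = - int (g * N) + int k * (int (g * m) + int (g * e)) - 2 * int k"
    by (simp add: algebra_simps)
  finally have "-1 \<le> - 2 * int k" using kN by linarith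
  then have "k = 0" by simp
  then have "int (g * N) \<le> 1" using b(1) by (simp add: N_def[symmetric] k_def[symmetric])
  then have "g * N \<le> 1" by linarith
  moreover have "N \<le> g * N" using assms(7) by simp
  ultimately show False using N2 by linarith
qed

text \<open>Were the residue of \<open>P / Q ^ m\<close> outside \<open>K\<close>, no polynomial in
  \<open>P\<close> and \<open>Q\<close> would lose degree. Both components of an inverse would then
  be of the form \<open>b * y + c\<close>, making \<open>x\<close> and \<open>y\<close> functions of
  \<open>Q\<close> alone. So the residue is a constant \<open>c\<close>, and
  \<open>P - c * Q ^ m\<close> has smaller degree.\<close>

lemma aut_reduce:
  assumes "f \<in> carrier GA2"
    and deg: "fls_subdegree (emb (fst f)) = - int (g * m)" "fls_subdegree (emb (snd f)) = - int g"
    and "m > 0" "g > 0" "g * m \<noteq> 1"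
  obtains c where "fls_subdegree (emb (fst f)) < fls_subdegree (emb (fst f) - cst c * emb (snd f) ^ m)"
proof -
  let ?P = "emb (fst f)" and ?Q = "emb (snd f)"
  note nz = aut_emb_nz[OF assms(1)]
  have deg': "fls_subdegree ?Q = - int (g * 1)" using deg by simp
  obtain h where h: "pcomp h f = pid" using assms(1) by (auto simp: carrier_GA2_iff simp del: split_paired_Ex)
  then have hx: "subst (fst h) f = var_x" and hy: "subst (snd h) f = var_y" by (auto simp: pcomp_def pid_def)
  have "\<exists>c. (?P ^ 1 / ?Q ^ m) $$ 0 = fls_const c"
  proof (rule ccontr)
    assume *: "\<not> ?thesis"
    have lin: "\<exists>b c. G = Const b * var_y + Const c" if G: "subst G f \<in> {var_x, var_y}" for G
    proof -
      define N where "N = Max ((\<lambda>p. m * fst p + 1 * snd p) ` supp G)"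
      note b = aut_inverse_pole_bound[OF assms(1) G deg(1) deg' _ assms(4) _ assms(5), folded N_def]
      have "g * N = 1" using b(2) * by simp
      have N: "m * fst p + 1 * snd p \<le> N" if "p \<in> supp G" for p
        using b(4)[OF _ _ that] by simp
      have "N = 1" "g = 1" using \<open>g * N = 1\<close> by auto
      have "m \<noteq> 1" using assms(6) \<open>g = 1\<close> by simp
      then have m2: "m \<ge> 2" using assms(4) by linarith
      \<comment> \<open>Weight at most 1 with \<open>m \<ge> 2\<close> leaves room only for the
        monomials 1 and \<open>y\<close>.\<close>
      have co: "coeff (coeff G i) j = 0" if "i > 0 \<or> i + j > 1" for i j
      proof (rule ccontr)
        assume "coeff (coeff G i) j \<noteq> 0"
        then have "m * i + j \<le> 1" using N[of "(i, j)"] \<open>N = 1\<close> by (simp add: supp_def)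
        moreover have "2 * i \<le> m * i" using m2 by simp
        ultimately show False using that by linarith
      qed
      obtain a b c where abc: "G = Const a * var_x + Const b * var_y + Const c"
        by (rule linear_formI[of G]) (use co in simp)
      have "a = 0" using co[of 1 0] unfolding abc coeff_linear_form by simp
      then show ?thesis using abc by (auto simp: Const_simps)
    qed
    obtain b c b' c' where "fst h = Const b * var_y + Const c" "snd h = Const b' * var_y + Const c'"
      using lin hx hy by (metis insertI1 insertI2)
    then have xy: "var_x = Const b * snd f + Const c" "var_y = Const b' * snd f + Const c'"
      using hx hy by (simp_all add: subst_add subst_mult)
    \<comment> \<open>Eliminating \<open>snd f\<close> leaves a linear relation between
      \<open>x\<close> and \<open>y\<close>, which forces \<open>b = 0\<close>.\<close>
    have "Const b' * var_x - Const b * var_y = Const b' * Const c - Const b * Const c'"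
      unfolding xy by (simp add: algebra_simps)
    also have "\<dots> = Const (b' * c - b * c')"
      by (simp add: Const_def)
    finally have "Const b' * var_x + Const (- b) * var_y + Const 0 =
        Const 0 * var_x + Const 0 * var_y + Const (b' * c - b * c')"
      by (simp add: Const_simps(1) Const_uminus)
    then have "b = 0" unfolding linear_form_eq_iff by simp
    then show False using xy(1) var_neq_Const(1)[of c] by (simp add: Const_simps)
  qed
  then obtain c where c: "(?P / ?Q ^ m) $$ 0 = fls_const c" by auto
  define z where "z = ?P / ?Q ^ m - cst c"
  have P: "?P - cst c * ?Q ^ m = z * ?Q ^ m" using nz by (simp add: z_def field_simps)
  have sP: "fls_subdegree (?P / ?Q ^ m) = 0"
    using nz deg by (simp add: subdegree_divide subdegree_power)
  have "val_ge z 1"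
    unfolding val_ge_def
  proof (intro allI impI)
    fix i :: int assume "i < 1"
    then show "z $$ i = 0" using c sP by (cases "i = 0") (auto simp: z_def cst_def)
  qed
  then have "fls_subdegree ?P < fls_subdegree (?P - cst c * ?Q ^ m)"
    unfolding P using nz deg assms(4,5) by (cases "z = 0") (auto simp: val_ge_iff subdegree_power)
  then show ?thesis using that by blast
qed

section \<open>Affine and elementary maps\<close>

definition aff :: "'a::field \<Rightarrow> 'a \<Rightarrow> 'a \<Rightarrow> 'a \<Rightarrow> 'a \<Rightarrow> 'a \<Rightarrow> 'a pmap" where
  "aff a b s c d t = (Const a * var_x + Const b * var_y + Const s, Const c * var_x + Const d * var_y + Const t)"

lemma affine_map_eq_aff: "affine_map M v = aff (M$1$1) (M$1$2) (v$1) (M$2$1) (M$2$2) (v$2)"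
  by (simp add: affine_map_def aff_def)

lemma Aff_iff: "f \<in> Aff \<longleftrightarrow> (\<exists>a b s c d t. a * d - b * c \<noteq> 0 \<and> f = aff a b s c d t)"
proof
  assume "f \<in> Aff"
  then obtain M v where "f = affine_map M v" "invertible M" by (auto simp: Aff_def)
  then have "f = aff (M$1$1) (M$1$2) (v$1) (M$2$1) (M$2$2) (v$2)" "M$1$1 * M$2$2 - M$1$2 * M$2$1 \<noteq> 0"
    by (simp_all add: affine_map_eq_aff invertible_det_nz det_2)
  then show "\<exists>a b s c d t. a * d - b * c \<noteq> 0 \<and> f = aff a b s c d t" by blast
next
  assume "\<exists>a b s c d t. a * d - b * c \<noteq> 0 \<and> f = aff a b s c d t"
  then obtain a b s c d t where *: "a * d - b * c \<noteq> 0" "f = aff a b s c d t" by blast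
  define M :: "'a^2^2" where "M = vector [vector [a, b], vector [c, d]]"
  define v :: "'a^2" where "v = vector [s, t]"
  have "f = affine_map M v" "invertible M"
    using * by (simp_all add: affine_map_eq_aff M_def v_def invertible_det_nz det_2)
  then show "f \<in> Aff" by (auto simp: Aff_def)
qed

lemma aff_eq_iff: "aff a b s c d t = aff a' b' s' c' d' t' \<longleftrightarrow>
    a = a' \<and> b = b' \<and> s = s' \<and> c = c' \<and> d = d' \<and> t = t'"
  by (auto simp: aff_def linear_form_eq_iff)

lemma pid_eq_aff: "pid = aff 1 0 0 0 1 0"
  by (simp add: pid_def aff_def Const_simps)

lemma pcomp_aff:
  "pcomp (aff a b s c d t) h =
    (Const a * fst h + Const b * snd h + Const s, Const c * fst h + Const d * snd h + Const t)"
  by (simp add: pcomp_def aff_def subst_add subst_mult)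

lemma pcomp_aff_aff:
  "pcomp (aff a b s c d t) (aff a' b' s' c' d' t') =
    aff (a * a' + b * c') (a * b' + b * d') (a * s' + b * t' + s)
      (c * a' + d * c') (c * b' + d * d') (c * s' + d * t' + t)"
  unfolding pcomp_aff unfolding aff_def by (simp add: Const_simps algebra_simps)

lemma eval_y_pcompose: "eval_y (pcompose p q) T = eval_y p (eval_y q T)"
  by (induction p) (simp_all add: pcompose_pCons eval_y_add eval_y_mult Const_simps)

lemma pcomp_elementary:
  "pcomp (elementary_map \<alpha> P \<beta> v) h = (Const \<alpha> * fst h + eval_y P (snd h), Const \<beta> * snd h + Const v)"
  by (simp add: pcomp_def elementary_map_def subst_add subst_mult subst_eval_y)

lemma pcomp_elementary_elementary:
  "pcomp (elementary_map \<alpha> P \<beta> v) (elementary_map \<alpha>' P' \<beta>' v') =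
    elementary_map (\<alpha> * \<alpha>') (Polynomial.smult \<alpha> P' + pcompose P [:v', \<beta>':]) (\<beta> * \<beta>') (\<beta> * v' + v)"
  unfolding pcomp_elementary unfolding elementary_map_def
  by (simp add: eval_y_pcompose eval_y_add eval_y_smult Const_simps algebra_simps)

lemma pid_eq_elementary: "pid = elementary_map 1 0 1 0"
  by (simp add: pid_def elementary_map_def Const_simps)

lemma elementary_map_eq_iff:
  "elementary_map \<alpha> P \<beta> v = elementary_map \<alpha>' P' \<beta>' v' \<longleftrightarrow> \<alpha> = \<alpha>' \<and> P = P' \<and> \<beta> = \<beta>' \<and> v = v'"
  unfolding elementary_map_def eval_y_var_y by (auto simp: var_x_def var_y_def Const_def)

text \<open>Right inverses within \<open>S\<close> suffice: a right inverse of a right inverse of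
  \<open>f\<close> is \<open>f\<close> itself.\<close>

lemma subgroup_GA2I:
  assumes "pid \<in> S" "\<And>f g. f \<in> S \<Longrightarrow> g \<in> S \<Longrightarrow> pcomp f g \<in> S"
    and "\<And>f. f \<in> S \<Longrightarrow> \<exists>g \<in> S. pcomp f g = pid"
  shows "subgroup S GA2"
proof -
  have inv: "\<exists>g \<in> S. pcomp f g = pid \<and> pcomp g f = pid" if f: "f \<in> S" for f
  proof -
    obtain g where g: "g \<in> S" "pcomp f g = pid" using assms(3)[OF f] by blast
    obtain h where h: "h \<in> S" "pcomp g h = pid" using assms(3)[OF g(1)] by blast
    have "f = pcomp f (pcomp g h)" by (simp add: h)
    also have "\<dots> = h" by (simp add: g flip: pcomp_assoc)
    finally show ?thesis using g h by blast
  qed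
  then have "S \<subseteq> carrier GA2" unfolding carrier_GA2_iff subset_iff by blast
  interpret group GA2 by (rule group_GA2)
  show ?thesis
  proof (rule subgroupI)
    fix f assume f: "f \<in> S"
    then obtain g where "g \<in> S" "pcomp g f = pid" using inv by blast
    then show "inv\<^bsub>GA2\<^esub> f \<in> S"
      using inv_equality[of g f] \<open>S \<subseteq> carrier GA2\<close> f by auto
  qed (use assms \<open>S \<subseteq> carrier GA2\<close> in auto)
qed

lemma subgroup_Aff: "subgroup (Aff :: 'a::field pmap set) GA2"
proof (rule subgroup_GA2I)
  have "(1 :: 'a) * 1 - 0 * 0 \<noteq> 0" by simp
  then show "pid \<in> (Aff :: 'a pmap set)" unfolding Aff_iff pid_eq_aff by blast
next
  fix f g :: "'a pmap" assume "f \<in> Aff" "g \<in> Aff"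
  then obtain a b s c d t a' b' s' c' d' t' where
    *: "a * d - b * c \<noteq> 0" "f = aff a b s c d t" "a' * d' - b' * c' \<noteq> 0" "g = aff a' b' s' c' d' t'"
    unfolding Aff_iff by blast
  have "(a * a' + b * c') * (c * b' + d * d') - (a * b' + b * d') * (c * a' + d * c') =
      (a * d - b * c) * (a' * d' - b' * c')" by (simp add: algebra_simps)
  then have "(a * a' + b * c') * (c * b' + d * d') - (a * b' + b * d') * (c * a' + d * c') \<noteq> 0"
    using * by simp
  then show "pcomp f g \<in> Aff" unfolding *(2,4) pcomp_aff_aff Aff_iff by blast
next
  fix f :: "'a pmap" assume "f \<in> Aff"
  then obtain a b s c d t where *: "a * d - b * c \<noteq> 0" "f = aff a b s c d t" unfolding Aff_iff by blast
  define D where "D = a * d - b * c"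
  define g where "g = aff (d / D) (- b / D) ((b * t - d * s) / D) (- c / D) (a / D) ((c * s - a * t) / D)"
  have D: "D \<noteq> 0" using * by (simp add: D_def)
  have "(d / D) * (a / D) - (- b / D) * (- c / D) = 1 / D"
  proof -
    have "(d / D) * (a / D) - (- b / D) * (- c / D) = (a * d - b * c) / (D * D)"
      by (simp add: diff_divide_distrib mult.commute)
    then show ?thesis using D by (simp flip: D_def)
  qed
  then have "g \<in> Aff" using D unfolding g_def Aff_iff by (metis divide_eq_0_iff one_neq_zero)
  moreover have "pcomp f g = pid"
    unfolding *(2) g_def pcomp_aff_aff pid_eq_aff aff_eq_iff using D
    by (simp add: field_simps) (simp add: D_def algebra_simps)
  ultimately show "\<exists>g\<in>Aff. pcomp f g = pid" by blast
qed

lemma subgroup_Elem: "subgroup (Elem :: 'a::field pmap set) GA2"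
proof (rule subgroup_GA2I)
  show "pid \<in> (Elem :: 'a pmap set)" unfolding Elem_def pid_eq_elementary by force
next
  fix f g :: "'a pmap" assume "f \<in> Elem" "g \<in> Elem"
  then obtain \<alpha> P \<beta> v \<alpha>' P' \<beta>' v' where
    *: "\<alpha> * \<beta> \<noteq> 0" "f = elementary_map \<alpha> P \<beta> v" "\<alpha>' * \<beta>' \<noteq> 0" "g = elementary_map \<alpha>' P' \<beta>' v'"
    unfolding Elem_def by blast
  have "\<alpha> * \<alpha>' * (\<beta> * \<beta>') \<noteq> 0" using * by simp
  then show "pcomp f g \<in> Elem" unfolding *(2,4) pcomp_elementary_elementary Elem_def by blast
next
  fix f :: "'a pmap" assume "f \<in> Elem"
  then obtain \<alpha> P \<beta> v where *: "\<alpha> * \<beta> \<noteq> 0" "f = elementary_map \<alpha> P \<beta> v" unfolding Elem_def by blast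
  define g where "g = elementary_map (1 / \<alpha>) (Polynomial.smult (- 1 / \<alpha>) (pcompose P [:- v / \<beta>, 1 / \<beta>:])) (1 / \<beta>) (- v / \<beta>)"
  have "1 / \<alpha> * (1 / \<beta>) \<noteq> 0" using * by simp
  then have "g \<in> Elem" unfolding g_def Elem_def by blast
  moreover have "pcomp f g = pid"
    unfolding *(2) g_def pcomp_elementary_elementary pid_eq_elementary elementary_map_eq_iff
    using *(1) by simp
  ultimately show "\<exists>g\<in>Elem. pcomp f g = pid" by blast
qed

lemma subgroup_Bas: "subgroup Bas GA2"
  unfolding Bas_def using group.subgroups_Inter_pair[OF group_GA2 subgroup_Aff subgroup_Elem] .

section \<open>Reduced words\<close>

text \<open>Coding the two factors by a Boolean turns alternation of letters into negation.\<close>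

definition side :: "bool \<Rightarrow> 'a::field pmap set" where
  "side b = (if b then Aff else Elem)"

lemma subgroup_side: "subgroup (side b) GA2"
  by (simp add: side_def subgroup_Aff subgroup_Elem)

lemma Bas_subset_side: "Bas \<subseteq> side b"
  by (auto simp: side_def Bas_def)

lemma subgroup_pcomp: "subgroup S GA2 \<Longrightarrow> f \<in> S \<Longrightarrow> g \<in> S \<Longrightarrow> pcomp f g \<in> S"
  using subgroup.m_closed[of S GA2 f g] by simp

lemma subgroup_pid: "subgroup S GA2 \<Longrightarrow> pid \<in> S"
  using subgroup.one_closed[of S GA2] by simp

lemma GA2_inv:
  assumes "f \<in> carrier GA2"
  shows "inv\<^bsub>GA2\<^esub> f \<in> carrier GA2" "pcomp (inv\<^bsub>GA2\<^esub> f) f = pid" "pcomp f (inv\<^bsub>GA2\<^esub> f) = pid"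
  using group.inv_closed[OF group_GA2 assms] group.l_inv[OF group_GA2 assms] group.r_inv[OF group_GA2 assms]
  by simp_all

lemma Bas_letter:
  assumes "h \<in> Bas" "g \<in> side b - Bas"
  shows "pcomp h g \<in> side b - Bas" "pcomp g h \<in> side b - Bas"
proof -
  have h: "h \<in> carrier GA2" "inv\<^bsub>GA2\<^esub> h \<in> Bas"
    using assms(1) subgroup.subset[OF subgroup_Bas] subgroup.m_inv_closed[OF subgroup_Bas] by blast+
  have hs: "h \<in> side b" using assms Bas_subset_side by blast
  have "pcomp (inv\<^bsub>GA2\<^esub> h) (pcomp h g) = g" "pcomp (pcomp g h) (inv\<^bsub>GA2\<^esub> h) = g"
    using GA2_inv[OF h(1)] by (simp_all add: pcomp_assoc) (simp flip: pcomp_assoc)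
  then have "pcomp h g \<notin> Bas" "pcomp g h \<notin> Bas"
    using h(2) assms(2) subgroup_pcomp[OF subgroup_Bas] by (metis Diff_iff)+
  then show "pcomp h g \<in> side b - Bas" "pcomp g h \<in> side b - Bas"
    using hs assms subgroup_pcomp[OF subgroup_side] by blast+
qed

text \<open>
  \<open>reduced b n f\<close>: \<open>f\<close> is an alternating word with \<open>n\<close> letters, up to elements of \<open>Bas\<close>, whose
  outermost letter is affine if \<open>b\<close> holds and elementary otherwise.
\<close>

inductive reduced :: "bool \<Rightarrow> nat \<Rightarrow> 'a::field pmap \<Rightarrow> bool" where
  reduced_Bas: "f \<in> Bas \<Longrightarrow> reduced b 0 f"
| reduced_Suc: "g \<in> side b - Bas \<Longrightarrow> reduced (\<not> b) n f \<Longrightarrow> reduced b (Suc n) (pcomp g f)"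

lemma reduced_carrier: "reduced b n f \<Longrightarrow> f \<in> carrier GA2"
proof (induction rule: reduced.induct)
  case (reduced_Bas f b)
  then show ?case using subgroup.subset[OF subgroup_Bas] by blast
next
  case (reduced_Suc g b n f)
  have "g \<in> carrier GA2" using subgroup.subset[OF subgroup_side] reduced_Suc(1) by blast
  then show ?case
    using monoid.m_closed[OF group.is_monoid[OF group_GA2], of g f] reduced_Suc by simp
qed

lemma reduced_Bas_left:
  assumes "reduced b n f" "h \<in> Bas"
  shows "reduced b n (pcomp h f)"
  using assms
proof (cases rule: reduced.cases)
  case reduced_Bas
  then show ?thesis using assms(2) by (simp add: reduced.reduced_Bas subgroup_pcomp[OF subgroup_Bas])
next
  case (reduced_Suc g n' f')
  have "reduced b (Suc n') (pcomp (pcomp h g) f')"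
    using reduced.reduced_Suc[OF Bas_letter(1)[OF assms(2) reduced_Suc(3)] reduced_Suc(4)] .
  then show ?thesis using reduced_Suc by (simp add: pcomp_assoc)
qed

text \<open>A letter on the side of the outermost one merges with it; a product falling into
  \<open>Bas\<close> is absorbed by the rest of the word.\<close>

lemma reduced_side_left:
  assumes "reduced b n f" "g \<in> side c"
  shows "\<exists>b n. reduced b n (pcomp g f)"
proof (cases "g \<in> Bas")
  case True then show ?thesis using reduced_Bas_left assms by blast
next
  case g: False
  show ?thesis
    using assms(1)
  proof (cases rule: reduced.cases)
    case reduced_Bas
    then have "reduced c (Suc 0) (pcomp g f)"
      using g assms(2) by (intro reduced.reduced_Suc reduced.reduced_Bas) auto
    then show ?thesis by blast
  next
    case (reduced_Suc g' n' f')
    show ?thesis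
    proof (cases "b = c")
      case False
      then have "reduced c (Suc n) (pcomp g f)"
        using g assms by (intro reduced.reduced_Suc) auto
      then show ?thesis by blast
    next
      case True
      have eq: "pcomp g f = pcomp (pcomp g g') f'" using reduced_Suc by (simp add: pcomp_assoc)
      have "g \<in> side b" "g' \<in> side b" using True assms(2) reduced_Suc(3) by simp_all
      then have "pcomp g g' \<in> side b" using subgroup_pcomp[OF subgroup_side] by blast
      then show ?thesis
        unfolding eq using reduced_Bas_left[OF reduced_Suc(4)] reduced.reduced_Suc[OF _ reduced_Suc(4)]
        by (cases "pcomp g g' \<in> Bas") blast+
    qed
  qed
qed

text \<open>The innermost letter of \<open>f\<close> is on side \<open>b\<close> exactly for odd
  \<open>n\<close>. The parity condition thus puts the outermost letter of \<open>g\<close> on the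
  opposite side, and no letters merge.\<close>

lemma reduced_append:
  "reduced b n f \<Longrightarrow> reduced (if even n then b else \<not> b) m g \<Longrightarrow> reduced b (n + m) (pcomp f g)"
proof (induction arbitrary: g rule: reduced.induct)
  case (reduced_Bas f b)
  then show ?case by (simp add: reduced_Bas_left)
next
  case (reduced_Suc h b n f)
  have "reduced (\<not> b) (n + m) (pcomp f g)" using reduced_Suc by (cases "even n") auto
  then show ?case using reduced.reduced_Suc[OF reduced_Suc(1)] by (simp add: pcomp_assoc)
qed

text \<open>The prescribed side is that of the innermost letter, so \<open>g\<close> merges with it
  and the word does not grow.\<close>

lemma reduced_side_right:
  "reduced b n f \<Longrightarrow> n > 0 \<Longrightarrow> g \<in> side (if odd n then b else \<not> b) \<Longrightarrow> \<exists>m\<le>n. reduced b m (pcomp f g)"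
proof (induction rule: reduced.induct)
  case (reduced_Suc h b n f)
  show ?case
  proof (cases "n = 0")
    case True
    then have f: "f \<in> Bas" using reduced_Suc(2) by (auto elim: reduced.cases)
    then have "pcomp h f \<in> side b" using Bas_letter reduced_Suc(1) by blast
    moreover have "g \<in> side b" using reduced_Suc True by simp
    ultimately have s: "pcomp (pcomp h f) g \<in> side b" using subgroup_pcomp[OF subgroup_side] by blast
    show ?thesis
    proof (cases "pcomp (pcomp h f) g \<in> Bas")
      case True then show ?thesis using reduced.reduced_Bas by blast
    next
      case False
      then have "reduced b (Suc 0) (pcomp (pcomp (pcomp h f) g) pid)"
        using s by (intro reduced.reduced_Suc reduced.reduced_Bas subgroup_pid[OF subgroup_Bas]) auto
      then show ?thesis by auto
    qed
  next
    case False
    then obtain m where "m \<le> n" "reduced (\<not> b) m (pcomp f g)"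
      using reduced_Suc by (cases "even n") auto
    then show ?thesis
      using reduced.reduced_Suc[OF reduced_Suc(1)] by (metis Suc_le_mono pcomp_assoc)
  qed
qed simp

section \<open>Tame generation\<close>

text \<open>Degree at most 1 gives the affine shape. The matrix is invertible because a relation
  between its rows would turn a nonzero linear form into a constant under substitution.\<close>

lemma linear_degree_imp_Aff:
  assumes f: "f \<in> carrier GA2" and "fls_subdegree (emb (fst f)) \<ge> -1" "fls_subdegree (emb (snd f)) \<ge> -1"
  shows "f \<in> Aff"
proof -
  have lin: "\<exists>a b c. p = Const a * var_x + Const b * var_y + Const c" if "fls_subdegree (emb p) \<ge> -1" for p :: "'a poly poly"
  proof -
    have "val_ge (emb p) (- int 1)" using that by (cases "p = 0") (auto simp: val_ge_iff)
    then show ?thesis using linear_formI[OF val_ge_emb[of p 1]] by metis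
  qed
  obtain a b s c d t where *: "fst f = Const a * var_x + Const b * var_y + Const s"
      "snd f = Const c * var_x + Const d * var_y + Const t"
    using lin[OF assms(2)] lin[OF assms(3)] by metis
  then have fa: "f = aff a b s c d t" by (simp add: aff_def prod_eq_iff)
  have key: "u = 0 \<and> v = 0" if "u * a + v * c = 0" "u * b + v * d = 0" for u v
  proof -
    have "subst (Const u * var_x + Const v * var_y + Const 0) f =
        Const (u * a + v * c) * var_x + Const (u * b + v * d) * var_y + Const (u * s + v * t)"
      by (simp add: subst_add subst_mult * Const_simps algebra_simps)
    also have "\<dots> = subst (Const 0 * var_x + Const 0 * var_y + Const (u * s + v * t)) f"
      using that by (simp add: subst_add subst_mult Const_simps)
    finally show ?thesis unfolding subst_eq_iff[OF f] linear_form_eq_iff by simp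
  qed
  have "a * d - b * c \<noteq> 0"
  proof
    assume "a * d - b * c = 0"
    \<comment> \<open>For determinant 0, both \<open>(d, -b)\<close> and \<open>(c, -a)\<close> are
      relations between the rows. All entries vanish, and then \<open>(1, 1)\<close> is a relation
      too.\<close>
    then have "d = 0 \<and> - b = 0" "c = 0 \<and> - a = 0" using key[of d "- b"] key[of c "- a"] by (simp_all add: mult.commute)
    then show False using key[of 1 1] by simp
  qed
  then show ?thesis using fa Aff_iff by blast
qed

lemma reduced_inv_side:
  assumes "reduced b n (pcomp g f)" "g \<in> side c"
  shows "\<exists>b n. reduced b n f"
proof -
  have g: "g \<in> carrier GA2" using assms(2) subgroup.subset[OF subgroup_side] by blast
  have "pcomp (inv\<^bsub>GA2\<^esub> g) (pcomp g f) = f" using GA2_inv(2)[OF g] by (simp flip: pcomp_assoc)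
  moreover have "inv\<^bsub>GA2\<^esub> g \<in> side c" using assms(2) subgroup.m_inv_closed[OF subgroup_side] by blast
  ultimately show ?thesis using reduced_side_left[OF assms(1)] by metis
qed

lemma pcomp_carrier: "f \<in> carrier GA2 \<Longrightarrow> g \<in> carrier GA2 \<Longrightarrow> pcomp f g \<in> carrier GA2"
  using monoid.m_closed[OF group.is_monoid[OF group_GA2], of f g] by simp

text \<open>Induction on the sum of the two degrees. Unless both are 1, one is a multiple of the
  other by \<open>aut_degree_dvd\<close>, and after a swap if necessary a shear from
  \<open>aut_reduce\<close> lowers the sum.\<close>

theorem GA2_reduced:
  assumes "f \<in> carrier GA2"
  shows "\<exists>b n. reduced b n f"
  using assms
proof (induction "nat (- fls_subdegree (emb (fst f)) - fls_subdegree (emb (snd f)))" arbitrary: f rule: less_induct)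
  case less
  define \<mu> where "\<mu> f = nat (- fls_subdegree (emb (fst f)) - fls_subdegree (emb (snd f)))" for f :: "'a pmap"
  have side_carrier: "g \<in> carrier GA2" if "g \<in> side c" for g :: "'a pmap" and c
    using that subgroup.subset[OF subgroup_side] by blast
  \<comment> \<open>Stated for any \<open>h\<close> of the same total degree, so that it covers
    \<open>f\<close> as well as \<open>f\<close> with its components swapped.\<close>
  have reducible: "\<exists>b n. reduced b n h"
    if h: "h \<in> carrier GA2" "\<mu> h = \<mu> f" "g > 0" "m > 0" "g * m \<noteq> 1"
      "fls_subdegree (emb (fst h)) = - int (g * m)" "fls_subdegree (emb (snd h)) = - int g" for h g m
  proof -
    obtain c where c: "fls_subdegree (emb (fst h)) < fls_subdegree (emb (fst h) - cst c * emb (snd h) ^ m)"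
      using aut_reduce[OF h(1,6,7,4,3,5)] by blast
    define E where "E = elementary_map 1 (monom (- c) m) 1 0"
    have "(1 :: 'a) * 1 \<noteq> 0" by simp
    then have E: "E \<in> side False" unfolding E_def side_def Elem_def if_False by blast
    have Eh: "pcomp E h = (fst h + eval_y (monom (- c) m) (snd h), snd h)"
      by (simp add: E_def pcomp_elementary Const_simps)
    have ca: "pcomp E h \<in> carrier GA2" using pcomp_carrier side_carrier[OF E] h(1) by blast
    have "\<mu> (pcomp E h) < \<mu> h"
      using c aut_subdegree_neg[OF ca] aut_subdegree_neg[OF h(1)]
      unfolding \<mu>_def Eh by (simp add: emb_add emb_eval_y cst_uminus)
    then have "\<exists>b n. reduced b n (pcomp E h)" using less.hyps[of "pcomp E h"] ca h(2) unfolding \<mu>_def by simp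
    then show ?thesis using reduced_inv_side[OF _ E] by blast
  qed
  let ?P = "emb (fst f)" and ?Q = "emb (snd f)"
  note neg = aut_subdegree_neg[OF less.prems]
  define g where "g = gcd (nat (- fls_subdegree ?P)) (nat (- fls_subdegree ?Q))"
  have gpos: "g > 0" using neg by (simp add: g_def)
  obtain m e where me: "nat (- fls_subdegree ?P) = m * g" "nat (- fls_subdegree ?Q) = e * g" "coprime m e"
    using gcd_coprime_exists[of "nat (- fls_subdegree ?P)" "nat (- fls_subdegree ?Q)"] gpos
    unfolding g_def[symmetric] by blast
  have deg: "fls_subdegree ?P = - int (g * m)" "fls_subdegree ?Q = - int (g * e)"
    using me neg unfolding mult.commute[of g] by linarith+
  have pos: "m > 0" "e > 0" using deg neg by (cases m; cases e; simp)+
  show ?case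
  proof (cases "g * m = 1 \<and> g * e = 1")
    case True
    then have "f \<in> side True"
      using linear_degree_imp_Aff[OF less.prems] deg by (simp add: side_def)
    moreover have "reduced True 0 (pid :: 'a pmap)"
      by (intro reduced_Bas subgroup_pid[OF subgroup_Bas])
    ultimately show ?thesis using reduced_side_left[of True 0 pid f True] by simp
  next
    case not1: False
    consider "e = 1" | "m = 1" using aut_degree_dvd[OF less.prems deg me(3) pos gpos] by blast
    then show ?thesis
    proof cases
      case 1
      then show ?thesis using reducible[OF less.prems _ gpos pos(1)] deg not1 by auto
    next
      case 2
      define S :: "'a pmap" where "S = aff 0 1 0 1 0 0"
      have "(0 :: 'a) * 0 - 1 * 1 \<noteq> 0" by simp
      then have S: "S \<in> side True" unfolding S_def side_def if_True Aff_iff by blast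
      have Sf: "pcomp S f = (snd f, fst f)" by (simp add: S_def pcomp_aff Const_simps)
      have ca: "pcomp S f \<in> carrier GA2" using pcomp_carrier side_carrier[OF S] less.prems by blast
      have "\<exists>b n. reduced b n (pcomp S f)"
        using reducible[OF ca _ gpos pos(2)] deg not1 2 by (simp add: \<mu>_def Sf)
      then show ?thesis using reduced_inv_side[OF _ S] by blast
    qed
  qed
qed

section \<open>Degree growth of reduced words\<close>

lemma eval1_pole:
  assumes "q \<noteq> 0" "fls_subdegree B < 0"
  shows "eval1 B q \<noteq> 0" "fls_subdegree (eval1 B q) = int (degree q) * fls_subdegree B"
proof -
  have cst: "cst = fls_const \<circ> fls_const" by (simp add: fun_eq_iff cst_def)
  have e: "eval1 B q = poly (map_poly fls_const (map_poly fls_const q)) B"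
    unfolding eval1_def cst by (simp add: map_poly_map_poly)
  have q: "map_poly fls_const q \<noteq> 0" "degree (map_poly fls_const q) = degree q"
    using assms(1) by (simp_all add: map_poly_eq_0_iff degree_map_poly)
  show "eval1 B q \<noteq> 0" "fls_subdegree (eval1 B q) = int (degree q) * fls_subdegree B"
    using poly_fls_const_pole[OF q(1) assms(2)] unfolding e q(2) by auto
qed

lemma Aff_degree:
  assumes "f \<in> Aff"
  shows "fls_subdegree (emb (fst f)) = -1" "fls_subdegree (emb (snd f)) = -1"
proof -
  have ca: "f \<in> carrier GA2" using assms subgroup.subset[OF subgroup_Aff] by blast
  have lin: "fls_subdegree (emb (Const a * var_x + Const b * var_y + Const c)) \<ge> -1" for a b c :: 'a
  proof -
    have "val_ge (emb (Const a * var_x + Const b * var_y + Const c)) (-1)"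
      unfolding emb_add emb_mult emb_Const emb_var
      by (simp add: val_ge_def cst_def mult.assoc[symmetric])
    then show ?thesis by (metis fls_zero_subdegree neg_le_0_iff_le val_ge_iff zero_le_one)
  qed
  obtain a b s c d t where "f = aff a b s c d t" using assms Aff_iff by blast
  then show "fls_subdegree (emb (fst f)) = -1" "fls_subdegree (emb (snd f)) = -1"
    using lin aut_subdegree_neg[OF ca] by (simp_all add: aff_def order_antisym)
qed

lemma subdegree_add_eq:
  fixes f g :: "'b::field fls"
  assumes "f \<noteq> 0" "val_ge g (fls_subdegree f + 1)"
  shows "fls_subdegree (f + g) = fls_subdegree f"
  using assms by (cases "g = 0") (auto simp: val_ge_iff intro: fls_subdegree_add_eq1)

text \<open>An elementary letter outside \<open>Bas\<close> makes the first degree at least twice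
  the second. An affine letter outside \<open>Bas\<close> moves the dominant degree to the second
  component. Dominance thus alternates, and two or more letters leave a component of degree at least
  2.\<close>

lemma reduced_degree:
  assumes "reduced b n f"
  defines "p \<equiv> - fls_subdegree (emb (fst f))" and "q \<equiv> - fls_subdegree (emb (snd f))"
  shows "p \<ge> 1 \<and> q \<ge> 1 \<and> (if b \<or> n = 0 then p \<le> q \<and> (n \<ge> 2 \<longrightarrow> q \<ge> 2) else q < p)"
  using assms(1) unfolding p_def q_def
proof (induction rule: reduced.induct)
  case (reduced_Bas f b)
  then have "f \<in> Aff" by (simp add: Bas_def)
  then show ?case by (simp add: Aff_degree)
next
  case (reduced_Suc g b n f)
  let ?P = "emb (fst f)" and ?Q = "emb (snd f)"
  have red: "reduced b (Suc n) (pcomp g f)" using reduced_Suc(1,2) by (rule reduced.reduced_Suc)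
  note neg = aut_subdegree_neg[OF reduced_carrier[OF red]]
    and neg' = aut_subdegree_neg[OF reduced_carrier[OF reduced_Suc(2)]]
  note nz' = aut_emb_nz[OF reduced_carrier[OF reduced_Suc(2)]]
  have val_cst: "val_ge (cst c) 0" for c :: 'a by (simp add: val_ge_def cst_def)
  have val_cst_mult: "val_ge (cst c * h) (fls_subdegree h)" for c :: 'a and h
    using val_ge_mult[OF val_cst val_ge_subdegree] by simp
  show ?case
  proof (cases b)
    case False
    then have g: "g \<in> Elem" "g \<notin> Bas" using reduced_Suc(1) by (auto simp: side_def)
    then obtain \<alpha> R \<beta> v where *: "\<alpha> * \<beta> \<noteq> 0" "g = elementary_map \<alpha> R \<beta> v" unfolding Elem_def by blast
    \<comment> \<open>Degree at most 1 would make \<open>g\<close> affine and hence an element of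
      \<open>Bas\<close>.\<close>
    have R: "degree R \<ge> 2"
    proof (rule ccontr)
      assume "\<not> degree R \<ge> 2"
      then have "degree R \<le> 1" by simp
      then have "R = [:coeff R 0, coeff R 1:]"
        by (intro poly_eqI) (auto simp: coeff_pCons coeff_eq_0 split: nat.split)
      then have "eval_y R var_y = Const (coeff R 1) * var_y + Const (coeff R 0)"
        by (metis add.commute add.right_neutral eval_y_simps mult.commute mult_zero_right)
      then have "g = aff \<alpha> (coeff R 1) (coeff R 0) 0 \<beta> v"
        by (simp add: * elementary_map_def aff_def Const_simps)
      moreover have "\<alpha> * \<beta> - coeff R 1 * 0 \<noteq> 0" using * by simp
      ultimately have "g \<in> Aff" using Aff_iff by blast
      then show False using g by (simp add: Bas_def)
    qed
    then have "R \<noteq> 0" by auto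
    have PQ: "- fls_subdegree ?P \<le> - fls_subdegree ?Q" using reduced_Suc.IH False by (auto split: if_splits)
    have eq: "emb (fst (pcomp g f)) = eval1 ?Q R + cst \<alpha> * ?P" "emb (snd (pcomp g f)) = cst \<beta> * ?Q + cst v"
      by (simp_all add: * pcomp_elementary emb_add emb_mult emb_eval_y)
    have sR: "fls_subdegree (eval1 ?Q R) \<le> 2 * fls_subdegree ?Q"
      using eval1_pole(2)[OF \<open>R \<noteq> 0\<close> neg'(2)] R neg'(2) by simp
    have "val_ge (cst \<alpha> * ?P) (fls_subdegree (eval1 ?Q R) + 1)"
      using val_ge_mono[OF val_cst_mult] sR PQ neg'(2) by simp
    then have 1: "fls_subdegree (emb (fst (pcomp g f))) \<le> 2 * fls_subdegree ?Q"
      unfolding eq using subdegree_add_eq[OF eval1_pole(1)[OF \<open>R \<noteq> 0\<close> neg'(2)]] sR by simp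
    have "\<beta> \<noteq> 0" using * by simp
    then have "cst \<beta> * ?Q \<noteq> 0" "fls_subdegree (cst \<beta> * ?Q) = fls_subdegree ?Q" using nz' by simp_all
    then have "fls_subdegree (emb (snd (pcomp g f))) = fls_subdegree ?Q"
      unfolding eq using subdegree_add_eq[of "cst \<beta> * ?Q" "cst v"] val_ge_mono[OF val_cst] neg'(2) by simp
    then show ?thesis using 1 neg neg'(2) False by simp
  next
    case True
    then have g: "g \<in> Aff" "g \<notin> Bas" using reduced_Suc(1) by (auto simp: side_def)
    show ?thesis
    proof (cases "n = 0")
      case n: True
      then have "f \<in> Aff" using reduced_Suc(2) by (auto elim: reduced.cases simp: Bas_def)
      then have "pcomp g f \<in> Aff" using g subgroup_pcomp[OF subgroup_Aff] by blast
      then show ?thesis using n True by (simp add: Aff_degree)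
    next
      case n: False
      obtain a b' s c d t where *: "a * d - b' * c \<noteq> 0" "g = aff a b' s c d t" using g Aff_iff by blast
      \<comment> \<open>With \<open>c = 0\<close> the map \<open>g\<close> would also be
        elementary.\<close>
      have "c \<noteq> 0"
      proof
        assume c: "c = 0"
        then have "g = elementary_map a [:s, b':] d t"
          by (simp add: * elementary_map_def aff_def Const_simps algebra_simps)
        moreover have "a * d \<noteq> 0" using * c by simp
        ultimately have "g \<in> Elem" unfolding Elem_def by blast
        then show False using g by (simp add: Bas_def)
      qed
      have PQ: "fls_subdegree ?P < fls_subdegree ?Q" using reduced_Suc.IH True n by simp
      have eq: "emb (fst (pcomp g f)) = cst a * ?P + cst b' * ?Q + cst s"
        "emb (snd (pcomp g f)) = cst c * ?P + (cst d * ?Q + cst t)"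
        by (simp_all add: * pcomp_aff emb_add emb_mult add.assoc)
      have "val_ge (emb (fst (pcomp g f))) (fls_subdegree ?P)"
        unfolding eq using PQ neg'(1)
        by (intro val_ge_add val_cst_mult val_ge_mono[OF val_cst_mult[of b' ?Q]] val_ge_mono[OF val_cst[of s]]) auto
      then have 1: "fls_subdegree (emb (fst (pcomp g f))) \<ge> fls_subdegree ?P"
        using aut_emb_nz[OF reduced_carrier[OF red]] by (simp add: val_ge_iff)
      have "val_ge (cst d * ?Q + cst t) (fls_subdegree ?P + 1)"
        using PQ neg'(1)
        by (intro val_ge_add val_ge_mono[OF val_cst_mult[of d ?Q]] val_ge_mono[OF val_cst[of t]]) auto
      moreover have "cst c * ?P \<noteq> 0" "fls_subdegree (cst c * ?P) = fls_subdegree ?P"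
        using nz' \<open>c \<noteq> 0\<close> by simp_all
      ultimately have "fls_subdegree (emb (snd (pcomp g f))) = fls_subdegree ?P"
        unfolding eq using subdegree_add_eq[of "cst c * ?P" "cst d * ?Q + cst t"] by simp
      then show ?thesis using 1 neg PQ neg'(2) True by simp
    qed
  qed
qed

lemma reduced_neq_pid:
  assumes "reduced b n f" "n \<ge> 2"
  shows "f \<noteq> pid"
proof
  assume "f = pid"
  moreover have "pid \<in> Aff" by (rule subgroup_pid[OF subgroup_Aff])
  ultimately show False
    using reduced_degree[OF assms(1)] assms(2) Aff_degree[of f] by (auto split: if_splits)
qed

section \<open>Elements of finite order\<close>

lemma conjugate_in_trans:
  assumes "group G" "a \<in> carrier G" "conjugate_in G a b" "conjugate_in G b c"
  shows "conjugate_in G a c"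
proof -
  interpret group G by (rule assms(1))
  obtain h k where hk: "h \<in> carrier G" "b = h \<otimes>\<^bsub>G\<^esub> a \<otimes>\<^bsub>G\<^esub> inv\<^bsub>G\<^esub> h" "k \<in> carrier G" "c = k \<otimes>\<^bsub>G\<^esub> b \<otimes>\<^bsub>G\<^esub> inv\<^bsub>G\<^esub> k"
    using assms(3,4) unfolding conjugate_in_def by blast
  have "c = (k \<otimes>\<^bsub>G\<^esub> h) \<otimes>\<^bsub>G\<^esub> a \<otimes>\<^bsub>G\<^esub> inv\<^bsub>G\<^esub> (k \<otimes>\<^bsub>G\<^esub> h)"
    using hk assms(2) by (simp add: m_assoc inv_mult_group)
  then show ?thesis unfolding conjugate_in_def using hk by blast
qed

lemma conjugate_in_mult:
  assumes "group G" "a \<in> carrier G" "a' \<in> carrier G" "h \<in> carrier G"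
  shows "(h \<otimes>\<^bsub>G\<^esub> a \<otimes>\<^bsub>G\<^esub> inv\<^bsub>G\<^esub> h) \<otimes>\<^bsub>G\<^esub> (h \<otimes>\<^bsub>G\<^esub> a' \<otimes>\<^bsub>G\<^esub> inv\<^bsub>G\<^esub> h) = h \<otimes>\<^bsub>G\<^esub> (a \<otimes>\<^bsub>G\<^esub> a') \<otimes>\<^bsub>G\<^esub> inv\<^bsub>G\<^esub> h"
proof -
  interpret group G by (rule assms(1))
  have "inv\<^bsub>G\<^esub> h \<otimes>\<^bsub>G\<^esub> (h \<otimes>\<^bsub>G\<^esub> (a' \<otimes>\<^bsub>G\<^esub> inv\<^bsub>G\<^esub> h)) = a' \<otimes>\<^bsub>G\<^esub> inv\<^bsub>G\<^esub> h"
    using assms by (simp add: m_assoc[symmetric])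
  then show ?thesis using assms by (simp add: m_assoc)
qed

lemma conjugate_in_self: "group G \<Longrightarrow> a \<in> carrier G \<Longrightarrow> conjugate_in G a a"
  unfolding conjugate_in_def
  using monoid.one_closed[OF group.is_monoid] by (intro bexI[of _ "\<one>\<^bsub>G\<^esub>"]) (simp_all add: group.is_monoid monoid.inv_one)

text \<open>The proper divisors of 4 divide 2, so excluding a trivial square makes the order exactly
  4.\<close>

definition order_4 :: "'a::field pmap \<Rightarrow> bool" where
  "order_4 f \<longleftrightarrow> f \<in> carrier GA2 \<and> pcomp f f \<noteq> pid \<and> pcomp (pcomp f f) (pcomp f f) = pid"

lemma order_4_conjugate:
  fixes f g :: "'a::field pmap"
  assumes "order_4 f" "conjugate_in GA2 f g"
  shows "order_4 g"
proof -
  interpret group "GA2 :: 'a pmap monoid" by (rule group_GA2)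
  obtain h where h: "h \<in> carrier GA2" "g = h \<otimes>\<^bsub>GA2\<^esub> f \<otimes>\<^bsub>GA2\<^esub> inv\<^bsub>GA2\<^esub> h"
    using assms(2) unfolding conjugate_in_def by blast
  have f: "f \<in> carrier GA2" using assms(1) by (simp add: order_4_def)
  have gg: "g \<otimes>\<^bsub>GA2\<^esub> g = h \<otimes>\<^bsub>GA2\<^esub> (f \<otimes>\<^bsub>GA2\<^esub> f) \<otimes>\<^bsub>GA2\<^esub> inv\<^bsub>GA2\<^esub> h"
    unfolding h(2) by (rule conjugate_in_mult[OF group_GA2 f f h(1)])
  have ff: "f \<otimes>\<^bsub>GA2\<^esub> f \<in> carrier GA2" by (rule m_closed[OF f f])
  have "(g \<otimes>\<^bsub>GA2\<^esub> g) \<otimes>\<^bsub>GA2\<^esub> (g \<otimes>\<^bsub>GA2\<^esub> g) = h \<otimes>\<^bsub>GA2\<^esub> ((f \<otimes>\<^bsub>GA2\<^esub> f) \<otimes>\<^bsub>GA2\<^esub> (f \<otimes>\<^bsub>GA2\<^esub> f)) \<otimes>\<^bsub>GA2\<^esub> inv\<^bsub>GA2\<^esub> h"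
    unfolding gg by (rule conjugate_in_mult[OF group_GA2 ff ff h(1)])
  also have "(f \<otimes>\<^bsub>GA2\<^esub> f) \<otimes>\<^bsub>GA2\<^esub> (f \<otimes>\<^bsub>GA2\<^esub> f) = \<one>\<^bsub>GA2\<^esub>" using assms(1) by (simp add: order_4_def)
  finally have 1: "(g \<otimes>\<^bsub>GA2\<^esub> g) \<otimes>\<^bsub>GA2\<^esub> (g \<otimes>\<^bsub>GA2\<^esub> g) = \<one>\<^bsub>GA2\<^esub>"
    using h(1) by (metis r_one r_inv)
  have 2: "g \<otimes>\<^bsub>GA2\<^esub> g \<noteq> \<one>\<^bsub>GA2\<^esub>"
  proof
    assume "g \<otimes>\<^bsub>GA2\<^esub> g = \<one>\<^bsub>GA2\<^esub>"
    then have "h \<otimes>\<^bsub>GA2\<^esub> (f \<otimes>\<^bsub>GA2\<^esub> f) = h"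
      using gg h(1) ff inv_solve_right'[of "\<one>\<^bsub>GA2\<^esub>" "h \<otimes>\<^bsub>GA2\<^esub> (f \<otimes>\<^bsub>GA2\<^esub> f)" h]
      by (metis inv_closed inv_equality inv_inv m_closed)
    then have "f \<otimes>\<^bsub>GA2\<^esub> f = \<one>\<^bsub>GA2\<^esub>" using h(1) ff by (metis l_cancel_one')
    then show False using assms(1) by (simp add: order_4_def)
  qed
  have "g \<in> carrier GA2" unfolding h(2) using h(1) f by blast
  then show ?thesis using 1 2 by (simp add: order_4_def)
qed

lemma order_4_conjugate_side:
  assumes "order_4 r"
  obtains q b where "conjugate_in GA2 r q" "q \<in> side b"
proof -
  have rc: "r \<in> carrier GA2" using assms by (simp add: order_4_def)
  define A where "A n \<longleftrightarrow> (\<exists>q b. conjugate_in GA2 r q \<and> reduced b n q)" for n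
  obtain b0 n0 where "reduced b0 n0 r" using GA2_reduced[OF rc] by blast
  then have "A n0" using conjugate_in_self[OF group_GA2 rc] unfolding A_def by blast
  define n where "n = (LEAST n. A n)"
  have "A n" unfolding n_def using \<open>A n0\<close> by (rule LeastI)
  have min: "n \<le> m" if "A m" for m unfolding n_def using that by (rule Least_le)
  obtain q b where q: "conjugate_in GA2 r q" "reduced b n q" using \<open>A n\<close> unfolding A_def by blast
  have q4: "order_4 q" by (rule order_4_conjugate[OF assms q(1)])
  have "n = 0 \<or> n = 1 \<or> n \<ge> 2 \<and> even n \<or> n \<ge> 3 \<and> odd n" by presburger
  then consider "n = 0" | "n = 1" | "n \<ge> 2" "even n" | "n \<ge> 3" "odd n" by blast
  then show ?thesis
  proof cases
    case 1
    then have "q \<in> Bas" using q(2) by (auto elim: reduced.cases)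
    then show ?thesis using that[OF q(1)] Bas_subset_side by blast
  next
    case 2
    from q(2) show ?thesis
    proof (cases rule: reduced.cases)
      case (reduced_Suc g n' f')
      then have "f' \<in> Bas" using 2 by (auto elim: reduced.cases)
      then have "q \<in> side b" using reduced_Suc Bas_letter(2)[of f' g b] by blast
      then show ?thesis using that[OF q(1)] by blast
    qed (use 2 in simp)
  next
    case 3
    \<comment> \<open>For even \<open>n\<close> the outermost and innermost letters of
      \<open>q\<close> are on different sides. Copies of \<open>q\<close> concatenate without
      merging, and the fourth power has \<open>4 * n\<close> letters.\<close>
    have "reduced b (n + n) (pcomp q q)" using reduced_append[OF q(2)] q(2) 3 by simp
    then have "reduced b ((n + n) + (n + n)) (pcomp (pcomp q q) (pcomp q q))"
      using reduced_append[of b "n + n"] by simp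
    then have "pcomp (pcomp q q) (pcomp q q) \<noteq> pid" using reduced_neq_pid 3 by fastforce
    then show ?thesis using q4 by (simp add: order_4_def)
  next
    case 4
    from q(2) show ?thesis
    proof (cases rule: reduced.cases)
      case (reduced_Suc g n' f')
      have n': "n' > 0" "even n'" using 4 reduced_Suc(1) by auto
      \<comment> \<open>For odd \<open>n\<close> the outermost letter \<open>g\<close> and the
        innermost one are on the same side. Conjugation moves \<open>g\<close> to the right end,
        where it merges, against the minimality of \<open>n\<close>.\<close>
      have "g \<in> side (if odd n' then \<not> b else \<not> \<not> b)" using n' reduced_Suc(3) by simp
      then obtain m where m: "m \<le> n'" "reduced (\<not> b) m (pcomp f' g)"
        using reduced_side_right[OF reduced_Suc(4) n'(1)] by blast
      have g: "g \<in> carrier GA2" using reduced_Suc(3) subgroup.subset[OF subgroup_side] by blast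
      have f': "f' \<in> carrier GA2" using reduced_Suc(4) reduced_carrier by blast
      have "pcomp f' g = inv\<^bsub>GA2\<^esub> g \<otimes>\<^bsub>GA2\<^esub> q \<otimes>\<^bsub>GA2\<^esub> inv\<^bsub>GA2\<^esub> (inv\<^bsub>GA2\<^esub> g)"
        using GA2_inv[OF g] g group.inv_inv[OF group_GA2 g] unfolding reduced_Suc(2)
        by (simp flip: pcomp_assoc)
      then have "conjugate_in GA2 q (pcomp f' g)"
        unfolding conjugate_in_def using GA2_inv(1)[OF g] by blast
      then have "A m" using conjugate_in_trans[OF group_GA2 rc q(1)] m(2) unfolding A_def by blast
      then show ?thesis using min[of m] m(1) reduced_Suc(1) by simp
    qed (use 4 in simp)
  qed
qed

text \<open>Both multipliers have fourth power 1, hence square 1, so the square of \<open>q\<close>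
  has the form \<open>(x + S(y), y + w)\<close>. Its own square is the identity, which gives
  \<open>2 * w = 0\<close> and then \<open>2 * S = 0\<close>, so the square of \<open>q\<close> is
  already trivial.\<close>

lemma no_order_4_in_Elem:
  fixes q :: "'a::field pmap"
  assumes "(2 :: 'a) \<noteq> 0" "\<And>z :: 'a. z ^ 4 = 1 \<Longrightarrow> z ^ 2 = 1" "q \<in> Elem"
  shows "\<not> order_4 q"
proof
  assume q4: "order_4 q"
  obtain \<alpha> P \<beta> v where q: "q = elementary_map \<alpha> P \<beta> v" using assms(3) unfolding Elem_def by blast
  define S where "S = Polynomial.smult \<alpha> P + pcompose P [:v, \<beta>:]"
  define w where "w = \<beta> * v + v"
  have qq: "pcomp q q = elementary_map (\<alpha> * \<alpha>) S (\<beta> * \<beta>) w"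
    by (simp add: q pcomp_elementary_elementary S_def w_def)
  have "pcomp (pcomp q q) (pcomp q q) = elementary_map 1 0 1 0"
    using q4 by (simp add: order_4_def pid_eq_elementary)
  then have *: "\<alpha> * \<alpha> * (\<alpha> * \<alpha>) = 1" "Polynomial.smult (\<alpha> * \<alpha>) S + pcompose S [:w, \<beta> * \<beta>:] = 0"
    "\<beta> * \<beta> * (\<beta> * \<beta>) = 1" "\<beta> * \<beta> * w + w = 0"
    unfolding qq pcomp_elementary_elementary elementary_map_eq_iff by auto
  have a: "\<alpha> * \<alpha> = 1" "\<beta> * \<beta> = 1"
    using assms(2)[of \<alpha>] assms(2)[of \<beta>] *(1,3) by (simp_all add: power2_eq_square power4_eq_xxxx mult.assoc)
  have "2 * w = 0" using *(4) a by simp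
  then have w: "w = 0" using assms(1) by simp
  have "S + S = 0" using *(2) a w by simp
  then have "Polynomial.smult (1 + 1) S = 0" by (simp only: smult_add_left smult_1_left)
  then have S: "S = 0" using assms(1) by simp
  then show False using q4 a w qq by (simp add: order_4_def pid_eq_elementary)
qed

text \<open>Let \<open>M\<close> be the linear part, with trace \<open>\<tau>\<close> and
  determinant \<open>\<delta>\<close>. From \<open>M ^ 4 = 1\<close> follows
  \<open>\<delta> ^ 4 = 1\<close>, hence \<open>\<delta> ^ 2 = 1\<close>. A nonzero trace would make
  \<open>M\<close> scalar with square 1. For trace 0, Cayley-Hamilton gives
  \<open>M ^ 2 = - \<delta>\<close>, so \<open>\<delta> = 1\<close>.\<close>

lemma order_4_in_Aff:
  fixes q :: "'a::field pmap"
  assumes two: "(2 :: 'a) \<noteq> 0" and i: "\<And>z :: 'a. z ^ 4 = 1 \<Longrightarrow> z ^ 2 = 1"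
    and "q \<in> Aff" "order_4 q"
  obtains a b s c t where "q = aff a b s c (- a) t" "b * c = - 1 - a * a" "c \<noteq> 0"
proof -
  obtain a b s c d t where q: "q = aff a b s c d t" using assms(3) Aff_iff by blast
  define A B S C D T where "A = a * a + b * c" and "B = a * b + b * d" and "S = a * s + b * t + s"
    and "C = c * a + d * c" and "D = c * b + d * d" and "T = c * s + d * t + t"
  have qq: "pcomp q q = aff A B S C D T"
    by (simp add: q pcomp_aff_aff A_def B_def S_def C_def D_def T_def)
  have "pcomp (pcomp q q) (pcomp q q) = aff 1 0 0 0 1 0"
    using assms(4) by (simp add: order_4_def pid_eq_aff)
  then have *: "A * A + B * C = 1" "A * B + B * D = 0" "A * S + B * T + S = 0"
    "C * A + D * C = 0" "C * B + D * D = 1" "C * S + D * T + T = 0"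
    unfolding qq pcomp_aff_aff aff_eq_iff by auto
  \<comment> \<open>If \<open>M ^ 2 = 1\<close>, the square of \<open>q\<close> is a translation of
    order at most 2, which is trivial because 2 is invertible.\<close>
  have not1: "\<not> (A = 1 \<and> B = 0 \<and> C = 0 \<and> D = 1)"
  proof
    assume 1: "A = 1 \<and> B = 0 \<and> C = 0 \<and> D = 1"
    then have "2 * S = 0" "2 * T = 0" using *(3,6) by simp_all
    then have "S = 0" "T = 0" using two by simp_all
    then show False using 1 qq assms(4) by (simp add: order_4_def pid_eq_aff)
  qed
  define \<delta> \<tau> where "\<delta> = a * d - b * c" and "\<tau> = a + d"
  have ABCD: "A = a * \<tau> - \<delta>" "B = b * \<tau>" "C = c * \<tau>" "D = d * \<tau> - \<delta>"
    by (simp_all add: A_def B_def C_def D_def \<delta>_def \<tau>_def algebra_simps)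
  have det: "A * D - B * C = \<delta> ^ 2"
    by (simp add: A_def B_def C_def D_def \<delta>_def algebra_simps power2_eq_square)
  have "(A * D - B * C) ^ 2 = (A * A + B * C) * (C * B + D * D) - (A * B + B * D) * (C * A + D * C)"
    by (simp add: algebra_simps power2_eq_square)
  also have "\<dots> = 1" using * by simp
  finally have "\<delta> ^ 4 = 1" unfolding det by simp
  then have \<delta>2: "\<delta> ^ 2 = 1" by (rule i)
  have "\<tau> = 0"
  proof (rule ccontr)
    assume \<tau>: "\<tau> \<noteq> 0"
    \<comment> \<open>A matrix \<open>M ^ 2\<close> of trace 0 and determinant 1 would have square
      -1 instead of 1.\<close>
    have AD: "A + D \<noteq> 0"
    proof
      assume "A + D = 0"
      then have "D = - A" by (simp add: eq_neg_iff_add_eq_0 add.commute)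
      then have "- (A * A + B * C) = 1" using det \<delta>2 by simp
      then have "- 1 = (1 :: 'a)" using *(1) by simp
      then show False using two by (metis add.inverse_inverse eq_neg_iff_add_eq_0 one_add_one)
    qed
    have "A * A + B * C = D * D + B * C" using *(1,5) by (simp add: mult.commute add.commute)
    then have "(A - D) * (A + D) = 0" by (simp add: algebra_simps)
    moreover have "B * (A + D) = 0" "C * (A + D) = 0"
      using *(2,4) by (simp_all add: algebra_simps)
    ultimately have 0: "B = 0" "C = 0" "A = D" using AD by simp_all
    then have bc: "b = 0" "c = 0" "a = d" using ABCD \<tau> by simp_all
    then have A: "A = a * a" "D = a * a" by (simp_all add: A_def D_def)
    have "a ^ 4 = 1" using *(1) 0 A by (simp add: power4_eq_xxxx mult.assoc)
    then have "a ^ 2 = 1" by (rule i)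
    then show False using not1 0 A by (simp add: power2_eq_square)
  qed
  then have d: "d = - a" by (simp add: \<tau>_def eq_neg_iff_add_eq_0 add.commute)
  have "\<delta> = 1 \<or> \<delta> = - 1" using \<delta>2 by (simp add: power2_eq_1_iff)
  then have \<delta>1: "\<delta> = 1" using not1 ABCD \<open>\<tau> = 0\<close> by auto
  have "b * c = - \<delta> - a * a" by (simp add: \<delta>_def d)
  then have bc: "b * c = - 1 - a * a" by (simp add: \<delta>1)
  \<comment> \<open>With \<open>c = 0\<close>, the entry \<open>a\<close> would be a square root of
    -1.\<close>
  have "c \<noteq> 0"
  proof
    assume "c = 0"
    then have a2: "a * a = - 1" using bc by (simp add: algebra_simps) 
    then have "a ^ 4 = 1" by (simp add: power4_eq_xxxx mult.assoc)
    then have "a ^ 2 = 1" by (rule i)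
    then have "- 1 = (1 :: 'a)" using a2 by (simp add: power2_eq_square)
    then show False using two by (metis add.inverse_inverse eq_neg_iff_add_eq_0 one_add_one)
  qed
  then show ?thesis using that q d bc by blast
qed

section \<open>Conjugation to the rotation matrix\<close>

lemma linear_map_R_mat: "linear_map (R_mat :: 'a::field^2^2) = aff 0 (-1) 0 1 0 0"
  by (simp add: linear_map_def affine_map_eq_aff R_mat_def)

text \<open>The conjugating map has second coordinate \<open>y - y\<^sub>0\<close>, where \<open>(x\<^sub>0, y\<^sub>0)\<close> is the fixed
  point of \<open>q\<close>, and its first coordinate is the pullback of the second one under \<open>q\<close>.\<close>

lemma order_4_Aff_conjugate_R:
  fixes a b s c t :: "'a::field"
  assumes two: "(2 :: 'a) \<noteq> 0" and "b * c = - 1 - a * a" "c \<noteq> 0"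
  shows "conjugate_in GA2 (aff a b s c (- a) t) (linear_map R_mat)"
proof -
  let ?q = "aff a b s c (- a) t"
  \<comment> \<open>Cramer's rule for the fixed point: the determinant of \<open>1 - M\<close> is
    \<open>1 - a * a - b * c = 2\<close>.\<close>
  define y0 where "y0 = (c * s + (1 - a) * t) / 2"
  define h where "h = aff c (- a) (t - y0) 0 1 (- y0)"
  have y0: "2 * y0 = c * s + (1 - a) * t" using two by (simp add: y0_def)
  have "c * 1 - (- a) * 0 \<noteq> 0" using assms by simp
  then have "h \<in> Aff" unfolding h_def Aff_iff by blast
  then have hc: "h \<in> carrier GA2" using subgroup.subset[OF subgroup_Aff] by blast
  have "a * (- a) - b * c \<noteq> 0" using assms(2) by simp
  then have "?q \<in> Aff" using Aff_iff by blast
  then have qc: "?q \<in> carrier GA2" using subgroup.subset[OF subgroup_Aff] by blast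
  have "c * b = - 1 - a * a" using assms(2) by (simp add: mult.commute)
  moreover have "c * s - a * t + (t - y0) = y0" using y0 by (simp add: algebra_simps)
  ultimately have "pcomp h ?q = pcomp (linear_map R_mat) h"
    unfolding h_def linear_map_R_mat pcomp_aff_aff aff_eq_iff by (simp add: algebra_simps)
  then have "linear_map R_mat = pcomp (pcomp h ?q) (inv\<^bsub>GA2\<^esub> h)"
    using GA2_inv(3)[OF hc] by (simp add: pcomp_assoc)
  then show ?thesis unfolding conjugate_in_def using hc by auto
qed

theorem theorem5:
  fixes f r :: "('a::field) pmap"
  assumes "CHAR('a) \<noteq> 2"
    and "{1, -1} \<subseteq> (roots_of_unity :: 'a set)"
    and "\<not> (\<exists>z \<in> (roots_of_unity :: 'a set). primitive_root_of_unity 4 z)"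
    and "f \<in> carrier GA2" and "CR_element f" and "reversible f"
    and "reversor f r" and "group.ord GA2 r = 4"
  shows "linear_map (R_mat :: 'a^2^2) \<in> Aff - Bas
    \<and> conjugate_in GA2 r (linear_map R_mat)
    \<and> (R_mat :: 'a^2^2) ** R_mat = vector [vector [-1, 0], vector [0, -1]]
    \<and> conjugate_in GA2 (r [^]\<^bsub>GA2\<^esub> (2::nat)) (linear_map (R_mat ** R_mat))"
proof (intro conjI)
  interpret group "GA2 :: 'a pmap monoid" by (rule group_GA2)
  have two: "(2 :: 'a) \<noteq> 0"
  proof
    assume "(2 :: 'a) = 0"
    then have "CHAR('a) dvd 2" using of_nat_eq_0_iff_char_dvd[where 'a = 'a, of 2] by simp
    then have "CHAR('a) = 1 \<or> CHAR('a) = 2" using prime_nat_iff[of 2] two_is_prime_nat by blast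
    then show False using assms(1) CHAR_not_1[where 'a = 'a] by simp
  qed
  \<comment> \<open>A solution of \<open>z ^ 4 = 1\<close> has order 1, 2 or 4, and order 4 is
    excluded by hypothesis.\<close>
  have i: "z ^ 2 = 1" if "z ^ 4 = 1" for z :: 'a
  proof (rule ccontr)
    assume z2: "z ^ 2 \<noteq> 1"
    have "z ^ k \<noteq> 1" if "0 < k" "k < 4" for k
    proof -
      have "z \<noteq> 1" using z2 by auto
      moreover have "z ^ 3 \<noteq> 1"
      proof
        assume "z ^ 3 = 1"
        then have "z = 1" using \<open>z ^ 4 = 1\<close> power_Suc[of z 3] by simp
        then show False using z2 by simp
      qed
      moreover have "k = 1 \<or> k = 2 \<or> k = 3" using that by linarith
      ultimately show ?thesis using z2 by auto
    qed
    then have "primitive_root_of_unity 4 z" using that by (simp add: primitive_root_of_unity_def)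
    moreover have "z \<in> roots_of_unity" using that unfolding roots_of_unity_def by (intro CollectI exI[of _ 4]) simp
    ultimately show False using assms(3) by blast
  qed
  have rc: "r \<in> carrier GA2" using assms(7) by (simp add: reversor_def)
  have pow2: "r [^]\<^bsub>GA2\<^esub> (2::nat) = pcomp r r"
    using rc by (simp add: numeral_2_eq_2)
  have pow4: "r [^]\<^bsub>GA2\<^esub> (4::nat) = pcomp (pcomp r r) (pcomp r r)"
    using nat_pow_mult[OF rc, of 2 2] pow2 by simp
  have r4: "order_4 r"
    using pow_eq_id[OF rc, of 2] pow_eq_id[OF rc, of 4] rc pow2 pow4 assms(8)
    by (simp add: order_4_def)
  obtain q b where q: "conjugate_in GA2 r q" "q \<in> side b" by (rule order_4_conjugate_side[OF r4])
  have q4: "order_4 q" by (rule order_4_conjugate[OF r4 q(1)])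
  then have "q \<in> Aff" using q(2) no_order_4_in_Elem[OF two i] by (auto simp: side_def split: if_splits)
  then have "conjugate_in GA2 q (linear_map R_mat)"
    using order_4_in_Aff[OF two i _ q4] order_4_Aff_conjugate_R[OF two] by metis
  then show conj: "conjugate_in GA2 r (linear_map R_mat)"
    by (rule conjugate_in_trans[OF group_GA2 rc q(1)])
  have "(0 :: 'a) * 0 - (- 1) * 1 \<noteq> 0" by simp
  then have "linear_map (R_mat :: 'a^2^2) \<in> Aff" unfolding linear_map_R_mat Aff_iff by blast
  moreover have "linear_map (R_mat :: 'a^2^2) \<notin> Elem"
  proof
    assume "linear_map (R_mat :: 'a^2^2) \<in> Elem"
    then obtain \<alpha> P \<beta> v where "aff 0 (-1) 0 1 0 0 = (elementary_map \<alpha> P \<beta> v :: 'a pmap)"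
      unfolding Elem_def linear_map_R_mat by blast
    \<comment> \<open>Compare second components: that of an elementary map does not involve
      \<open>x\<close>.\<close>
    then have "Const (1 :: 'a) * var_x + Const 0 * var_y + Const 0 = Const 0 * var_x + Const \<beta> * var_y + Const v"
      unfolding aff_def elementary_map_def by (simp add: Const_simps)
    then show False unfolding linear_form_eq_iff by simp
  qed
  ultimately show "linear_map (R_mat :: 'a^2^2) \<in> Aff - Bas" by (simp add: Bas_def)
  show RR: "(R_mat :: 'a^2^2) ** R_mat = vector [vector [-1, 0], vector [0, -1]]"
    by (simp add: R_mat_def matrix_matrix_mult_def vec_eq_iff forall_2 sum_2)
  have "pcomp (linear_map (R_mat :: 'a^2^2)) (linear_map R_mat) = linear_map (R_mat ** R_mat)"
    unfolding RR linear_map_R_mat pcomp_aff_aff by (simp add: linear_map_def affine_map_eq_aff)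
  \<comment> \<open>The conjugator of \<open>r\<close> also conjugates the squares.\<close>
  moreover obtain h where h: "h \<in> carrier GA2" "linear_map R_mat = h \<otimes>\<^bsub>GA2\<^esub> r \<otimes>\<^bsub>GA2\<^esub> inv\<^bsub>GA2\<^esub> h"
    using conj unfolding conjugate_in_def by blast
  ultimately have "linear_map (R_mat ** R_mat) = h \<otimes>\<^bsub>GA2\<^esub> (pcomp r r) \<otimes>\<^bsub>GA2\<^esub> inv\<^bsub>GA2\<^esub> h"
    using conjugate_in_mult[OF group_GA2 rc rc h(1)] by simp
  then show "conjugate_in GA2 (r [^]\<^bsub>GA2\<^esub> (2::nat)) (linear_map (R_mat ** R_mat))"
    unfolding conjugate_in_def pow2 using h(1) by blast
qed

end
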